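(* For every constant $\gamma>0$ there exist constants $c,C>0$ (depending only on $\gamma$) such that the following holds. Let $\{\mathbf{P}_v\}_{v\in\mathcal{V}}$ be a family of distributions over $\mathcal{X}$ indexed by a finite set $\mathcal{V}$, and let $M$ be an $(\varepsilon,\delta)$-pan-private online algorithm on streams of length $n$ such that $d_{TV}(M(\mathbf{P}_V^n),M(\mathbf{U}^n))\ge\gamma$. Then $n\ge C/\big(\varepsilon\|\{\mathbf{P}_v\}\|_{\infty\to2}+\sqrt{\delta\log(|\mathcal{V}|/\delta)}\big)$. In particular, if additionally $\delta\log(|\mathcal{V}|/\delta)\le c\,\varepsilon^2\|\{\mathbf{P}_v\}\|_{\infty\to2}^2$, then $n\ge C/(\varepsilon\|\{\mathbf{P}_v\}\|_{\infty\to 2})$.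
   Context: $V$ is uniform over $\mathcal{V}$; $\mathbf{U}=\mathbb{E}_{v\sim V}[\mathbf{P}_v]$ is the uniform mixture; $\mathbf{U}^n$ is $n$ i.i.d. samples from $\mathbf{U}$; $\mathbf{P}_V^n=\mathbb{E}_{v\sim V}[\mathbf{P}_v^n]$ is the distribution obtained by drawing $v\sim V$ once and then $n$ i.i.d. samples from $\mathbf{P}_v$. $M(\mathbf{D})$ denotes the distribution of the output of $M$ on a stream drawn from $\mathbf{D}$. The $(\infty\to2)$-norm is $\|\{\mathbf{P}_v\}\|_{\infty\to2}=\sup_{f:\mathcal{X}\to[-1,1]}\big(\mathbb{E}_{v\sim V}\big[(\mathbb{E}_{x\sim\mathbf{P}_v}[f(x)]-\mathbb{E}_{x\sim\mathbf{U}}[f(x)])^2\big]\big)^{1/2}$. Pan-privacy: An online algorithm $M$ on streams $\vec x=(x_1,\dots,x_n)$ over $\mathcal{X}$ consists of randomized maps $M_1:\mathcal{X}\to\mathcal{I}$, $M_i:\mathcal{X}\times\mathcal{I}\to\mathcal{I}$ ($i\ge2$) and an output map $M_{\mathcal{O}}:\mathcal{I}\to\mathcal{O}$; it computes $s_1=M_1(x_1)$, $s_i=M_i(x_i,s_{i-1})$. $M_{\mathcal{I}}(\vec x)$ is the internal state after processing $\vec x$, $\vec x_{\le t}$ the first $t$ elements, and the output is $M(\vec x)=M_{\mathcal{O}}(M_{\mathcal{I}}(\vec x))$. Streams are neighbors if they differ in at most one element. $M$ is $(\varepsilon,\delta)$-pan-private if for all neighboring $\vec x,\vec x'$, every $t$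 and every $T\subseteq\mathcal{I}\times\mathcal{O}$, $\Pr[(M_{\mathcal{I}}(\vec x_{\le t}),M_{\mathcal{O}}(M_{\mathcal{I}}(\vec x)))\in T]\le e^{\varepsilon}\Pr[(M_{\mathcal{I}}(\vec x'_{\le t}),M_{\mathcal{O}}(M_{\mathcal{I}}(\vec x')))\in T]+\delta$ (state and output from the same run).
   Formalization: The claim fails for unbounded ε, so it is proved for 0 ≤ ε ≤ ε₀ (any fixed ε₀) with c, C depending on γ and ε₀; δ is taken in [0,1], n ≥ 1, and c, C are chosen after fixing the ambient types that contain the spaces and 𝒱. *)

theory Defs
  imports "HOL-Probability.Probability"
begin

text \<open>A distribution over a measurable space \<open>X\<close> is an element of \<open>space (prob_algebra X)\<close>, and a
  randomized map from \<open>X\<close> to \<open>Y\<close> is a Markov kernel, i.e. an element of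
  \<open>X \<rightarrow>\<^sub>M prob_algebra Y\<close>.\<close>

section \<open>Families of distributions\<close>

definition uniform_mixture :: "'v set \<Rightarrow> ('v \<Rightarrow> 'x measure) \<Rightarrow> 'x measure" where
  "uniform_mixture V P = uniform_count_measure V \<bind> P"

text \<open>A stream of length \<open>n\<close> is a function on \<open>{1..n}\<close>.\<close>

definition iid :: "nat \<Rightarrow> 'x measure \<Rightarrow> (nat \<Rightarrow> 'x) measure" where
  "iid n D = PiM {1..n} (\<lambda>_. D)"

definition mixture_of_iid :: "nat \<Rightarrow> 'v set \<Rightarrow> ('v \<Rightarrow> 'x measure) \<Rightarrow> (nat \<Rightarrow> 'x) measure" where
  "mixture_of_iid n V P = uniform_count_measure V \<bind> (\<lambda>v. iid n (P v))"

definition inf_to_2_norm :: "'x measure \<Rightarrow> 'v set \<Rightarrow> ('v \<Rightarrow> 'x measure) \<Rightarrow> real" where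
  "inf_to_2_norm X V P =
    (SUP f \<in> {f \<in> borel_measurable X. \<forall>x\<in>space X. f x \<in> {-1..1::real}}.
       sqrt (\<integral>v. ((\<integral>x. f x \<partial>P v) - (\<integral>x. f x \<partial>uniform_mixture V P))\<^sup>2 \<partial>uniform_count_measure V))"

definition tv_dist :: "'a measure \<Rightarrow> 'a measure \<Rightarrow> real" where
  "tv_dist \<mu> \<nu> = (SUP A\<in>sets \<mu>. \<bar>measure \<mu> A - measure \<nu> A\<bar>)"

section \<open>Online algorithms\<close>

record ('x, 's, 'o) online_alg =
  init_map :: "'x \<Rightarrow> 's measure"
  step_map :: "nat \<Rightarrow> 'x \<times> 's \<Rightarrow> 's measure"
  output_map :: "'s \<Rightarrow> 'o measure"

definition online_algorithm ::
  "'x measure \<Rightarrow> 's measure \<Rightarrow> 'o measure \<Rightarrow> nat \<Rightarrow> ('x, 's, 'o) online_alg \<Rightarrow> bool" where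
  "online_algorithm X S Y n M \<longleftrightarrow>
     init_map M \<in> X \<rightarrow>\<^sub>M prob_algebra S \<and>
     (\<forall>i\<in>{2..n}. step_map M i \<in> X \<Otimes>\<^sub>M S \<rightarrow>\<^sub>M prob_algebra S) \<and>
     output_map M \<in> S \<rightarrow>\<^sub>M prob_algebra Y"

text \<open>\<open>evolve S M x t k s\<close> is the distribution of the state after \<open>t + k\<close> elements of \<open>x\<close>, given that
  the state after \<open>t\<close> elements is \<open>s\<close>.\<close>

primrec evolve ::
  "'s measure \<Rightarrow> ('x, 's, 'o) online_alg \<Rightarrow> (nat \<Rightarrow> 'x) \<Rightarrow> nat \<Rightarrow> nat \<Rightarrow> 's \<Rightarrow> 's measure" where
  "evolve S M x t 0 s = return S s"
| "evolve S M x t (Suc k) s =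
     evolve S M x t k s \<bind> (\<lambda>s'. step_map M (t + k + 1) (x (t + k + 1), s'))"

text \<open>The state after \<open>t\<close> elements; meaningful only for \<open>t \<ge> 1\<close>, as there is no state before the
  first element.\<close>

definition state_after ::
  "'s measure \<Rightarrow> ('x, 's, 'o) online_alg \<Rightarrow> (nat \<Rightarrow> 'x) \<Rightarrow> nat \<Rightarrow> 's measure" where
  "state_after S M x t = init_map M (x 1) \<bind> evolve S M x 1 (t - 1)"

definition run_output ::
  "'s measure \<Rightarrow> ('x, 's, 'o) online_alg \<Rightarrow> nat \<Rightarrow> (nat \<Rightarrow> 'x) \<Rightarrow> 'o measure" where
  "run_output S M n x = state_after S M x n \<bind> output_map M"

definition output_dist ::
  "'s measure \<Rightarrow> ('x, 's, 'o) online_alg \<Rightarrow> nat \<Rightarrow> (nat \<Rightarrow> 'x) measure \<Rightarrow> 'o measure" where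
  "output_dist S M n D = D \<bind> run_output S M n"

text \<open>Joint law of the state after \<open>t\<close> elements and the final output in a single run: the run is
  continued from the observed state.\<close>

definition state_output ::
  "'s measure \<Rightarrow> 'o measure \<Rightarrow> ('x, 's, 'o) online_alg \<Rightarrow> nat \<Rightarrow> (nat \<Rightarrow> 'x) \<Rightarrow> nat \<Rightarrow> ('s \<times> 'o) measure" where
  "state_output S Y M n x t =
     state_after S M x t \<bind> (\<lambda>s. evolve S M x t (n - t) s \<bind> (\<lambda>s'.
       output_map M s' \<bind> (\<lambda>y. return (S \<Otimes>\<^sub>M Y) (s, y))))"

definition neighbors :: "nat \<Rightarrow> (nat \<Rightarrow> 'x) \<Rightarrow> (nat \<Rightarrow> 'x) \<Rightarrow> bool" where
  "neighbors n x x' \<longleftrightarrow> card {i\<in>{1..n}. x i \<noteq> x' i} \<le> 1"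

definition pan_private ::
  "'x measure \<Rightarrow> 's measure \<Rightarrow> 'o measure \<Rightarrow> nat \<Rightarrow> real \<Rightarrow> real \<Rightarrow> ('x, 's, 'o) online_alg \<Rightarrow> bool" where
  "pan_private X S Y n \<epsilon> \<delta> M \<longleftrightarrow>
     (\<forall>x \<in> {1..n} \<rightarrow>\<^sub>E space X. \<forall>x' \<in> {1..n} \<rightarrow>\<^sub>E space X. neighbors n x x' \<longrightarrow>
       (\<forall>t\<in>{1..n}. \<forall>T\<in>sets (S \<Otimes>\<^sub>M Y).
          measure (state_output S Y M n x t) T
            \<le> exp \<epsilon> * measure (state_output S Y M n x' t) T + \<delta>))"

end

theory Submission
  imports Defs
begin

text \<open>Let the first \<open>t\<close> samples of a stream come from the uniform mixture \<open>U\<close> and the others from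
  \<open>P v\<close>, with \<open>v\<close> uniform; as \<open>t\<close> runs from \<open>0\<close> to \<open>n\<close> this interpolates between the two
  distributions of the theorem. Consecutive hybrids differ in the sample \<open>t\<close> alone. Given \<open>v\<close>, the
  output depends on that sample only through the state after \<open>t\<close> elements, and because the earlier
  samples do not depend on \<open>v\<close>, pan-privacy makes this state an \<open>(\<epsilon>, \<delta>)\<close>-private function
  of one sample. The state thus distinguishes \<open>P v\<close> from \<open>U\<close> with average advantage at most
  \<open>(exp \<epsilon> - 1) * N + 4 * \<delta>\<close>, where \<open>N\<close> is the norm of the family, and summing over \<open>t\<close>
  bounds the total variation distance by \<open>n\<close> times that.
  The term \<open>\<delta>\<close> is absorbed by the square root: \<open>card V = 1\<close> is impossible, since then the two
  distributions agree, so \<open>ln (card V / \<delta>) \<ge> ln 2\<close>.\<close>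

subsection \<open>Test functions and mixtures\<close>

text \<open>Restricting both measures to \<open>Z\<close> by an indicator density turns the
  hypothesis on subsets of \<open>Z\<close> into the order on measures, under which nonnegative
  integrals are monotone. The bounds on \<open>h\<close> make it integrable, which carries the
  inequality back to the Bochner integral.\<close>

lemma integral_le_of_emeasure_le:
  fixes h :: "'a \<Rightarrow> real"
  assumes "finite_measure \<mu>" "finite_measure \<nu>" "sets \<nu> = sets \<mu>" "Z \<in> sets \<mu>"
    and le: "\<And>A. A \<in> sets \<mu> \<Longrightarrow> A \<subseteq> Z \<Longrightarrow> emeasure \<nu> A \<le> emeasure \<mu> A"
    and h: "h \<in> borel_measurable \<mu>" "\<And>x. x \<in> space \<mu> \<Longrightarrow> 0 \<le> h x \<and> h x \<le> 1"
  shows "(\<integral>x. h x * indicator Z x \<partial>\<nu>) \<le> (\<integral>x. h x * indicator Z x \<partial>\<mu>)"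
proof -
  interpret M: finite_measure \<mu> by fact
  interpret N: finite_measure \<nu> by fact
  note [measurable_cong] = assms(3)
  note [measurable] = assms(4) h(1)
  have sp: "space \<nu> = space \<mu>"
    by (rule sets_eq_imp_space_eq) fact
  have "density \<nu> (indicator Z) \<le> density \<mu> (indicator Z)"
  proof (subst le_measure)
    show "sets (density \<nu> (indicator Z)) = sets (density \<mu> (indicator Z))"
      using assms(3) by simp
    show "\<forall>A\<in>sets (density \<nu> (indicator Z)). emeasure (density \<nu> (indicator Z)) A
        \<le> emeasure (density \<mu> (indicator Z)) A"
    proof
      fix A assume "A \<in> sets (density \<nu> (indicator Z))"
      then have [measurable]: "A \<in> sets \<mu>"
        using assms(3) by simp
      show "emeasure (density \<nu> (indicator Z)) A \<le> emeasure (density \<mu> (indicator Z)) A"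
        using le[of "Z \<inter> A"] by (simp add: emeasure_density assms(3) flip: indicator_inter_arith)
    qed
  qed
  then have "nn_integral (density \<nu> (indicator Z)) (\<lambda>x. ennreal (h x))
      \<le> nn_integral (density \<mu> (indicator Z)) (\<lambda>x. ennreal (h x))"
    using assms(3) by (intro nn_integral_mono_measure) auto
  moreover have eq: "(\<lambda>x. indicator Z x * ennreal (h x)) = (\<lambda>x. ennreal (h x * indicator Z x))"
    by (auto split: split_indicator)
  ultimately have "(\<integral>\<^sup>+x. ennreal (h x * indicator Z x) \<partial>\<nu>) \<le> (\<integral>\<^sup>+x. ennreal (h x * indicator Z x) \<partial>\<mu>)"
    by (simp add: nn_integral_density)
  moreover have nn: "0 \<le> h x * indicator Z x" if "x \<in> space \<mu>" for x
    using h(2)[OF that] by simp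
  moreover have "(\<integral>\<^sup>+x. ennreal (h x * indicator Z x) \<partial>\<nu>) = ennreal (\<integral>x. h x * indicator Z x \<partial>\<nu>)"
    by (intro nn_integral_eq_integral AE_I2 N.integrable_const_bound[where B=1])
       (use h nn sp in \<open>auto split: split_indicator\<close>)
  moreover have "(\<integral>\<^sup>+x. ennreal (h x * indicator Z x) \<partial>\<mu>) = ennreal (\<integral>x. h x * indicator Z x \<partial>\<mu>)"
    by (intro nn_integral_eq_integral AE_I2 M.integrable_const_bound[where B=1])
       (use h nn in \<open>auto split: split_indicator\<close>)
  moreover have "0 \<le> (\<integral>x. h x * indicator Z x \<partial>\<mu>)"
    by (rule Bochner_Integration.integral_nonneg) (rule nn)
  ultimately show ?thesis by simp
qed

text \<open>For a Hahn set \<open>A\<close> of the difference of the measures, raising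
  \<open>g\<close> to 1 on \<open>A\<close> and lowering it to 0 off \<open>A\<close> can only
  increase the advantage. The set is chosen before \<open>g\<close>, so a test function on states
  can later be traded for one measurable set.\<close>

lemma Hahn_set_optimal:
  assumes "prob_space \<mu>" "prob_space \<nu>" "sets \<nu> = sets \<mu>"
  shows "\<exists>A\<in>sets \<mu>. \<forall>g\<in>borel_measurable \<mu>. (\<forall>x\<in>space \<mu>. 0 \<le> g x \<and> g x \<le> (1::real)) \<longrightarrow>
    (\<integral>x. g x \<partial>\<mu>) - (\<integral>x. g x \<partial>\<nu>) \<le> measure \<mu> A - measure \<nu> A"
proof -
  interpret M: prob_space \<mu> by fact
  interpret N: prob_space \<nu> by fact
  note [measurable_cong] = assms(3)
  have sp: "space \<nu> = space \<mu>"
    by (rule sets_eq_imp_space_eq) fact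
  obtain A where A[measurable]: "A \<in> sets \<mu>"
    and pos: "\<And>B. B \<in> sets \<mu> \<Longrightarrow> B \<subseteq> A \<Longrightarrow> emeasure \<nu> B \<le> emeasure \<mu> B"
    and neg: "\<And>B. B \<in> sets \<mu> \<Longrightarrow> B \<inter> A = {} \<Longrightarrow> emeasure \<mu> B \<le> emeasure \<nu> B"
    using finite_unsigned_Hahn_decomposition[OF M.finite_measure_axioms N.finite_measure_axioms assms(3)]
    by metis
  show ?thesis
  proof (intro bexI[OF _ A] ballI impI)
    fix g :: "'a \<Rightarrow> real" assume g[measurable]: "g \<in> borel_measurable \<mu>"
      and b: "\<forall>x\<in>space \<mu>. 0 \<le> g x \<and> g x \<le> 1"
    let ?B = "space \<mu> - A"
    have neg': "emeasure \<mu> B \<le> emeasure \<nu> B" if "B \<in> sets \<mu>" "B \<subseteq> ?B" for B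
      by (rule neg) (use that in auto)
    have 1: "(\<integral>x. g x * indicator ?B x \<partial>\<mu>) \<le> (\<integral>x. g x * indicator ?B x \<partial>\<nu>)"
      by (rule integral_le_of_emeasure_le)
         (use b neg' assms(3) sp M.finite_measure_axioms N.finite_measure_axioms in auto)
    have 2: "(\<integral>x. (1 - g x) * indicator A x \<partial>\<nu>) \<le> (\<integral>x. (1 - g x) * indicator A x \<partial>\<mu>)"
      by (rule integral_le_of_emeasure_le)
         (use b pos assms(3) sp M.finite_measure_axioms N.finite_measure_axioms in auto)
    \<comment> \<open>This writes \<open>g\<close> as the indicator of \<open>A\<close>, plus what
      lies off \<open>A\<close>, minus what is missing from 1 on \<open>A\<close>. Facts
      \<open>1\<close> and \<open>2\<close> say that both corrections lower the difference of the
      two integrals.\<close>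
    have split: "(\<integral>x. g x \<partial>\<rho>) = (\<integral>x. g x * indicator ?B x \<partial>\<rho>) - (\<integral>x. (1 - g x) * indicator A x \<partial>\<rho>) + measure \<rho> A"
      if "prob_space \<rho>" and s[measurable_cong]: "sets \<rho> = sets \<mu>" for \<rho>
    proof -
      interpret prob_space \<rho> by fact
      have sp: "space \<rho> = space \<mu>"
        by (rule sets_eq_imp_space_eq) fact
      have [simp]: "integrable \<rho> (\<lambda>x. g x * indicator ?B x)" "integrable \<rho> (\<lambda>x. (1 - g x) * indicator A x)"
        by (rule integrable_const_bound[where B=1]; use b sp in \<open>auto split: split_indicator\<close>)+
      have [simp]: "integrable \<rho> (indicator A :: _ \<Rightarrow> real)"
        by (rule integrable_const_bound[where B=1]) (auto split: split_indicator)
      have "(\<integral>x. g x \<partial>\<rho>) = (\<integral>x. g x * indicator ?B x - (1 - g x) * indicator A x + indicator A x \<partial>\<rho>)"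
        by (intro Bochner_Integration.integral_cong) (auto simp: sp split: split_indicator)
      also have "\<dots> = (\<integral>x. g x * indicator ?B x \<partial>\<rho>) - (\<integral>x. (1 - g x) * indicator A x \<partial>\<rho>) + measure \<rho> A"
        using A s by simp
      finally show ?thesis .
    qed
    show "(\<integral>x. g x \<partial>\<mu>) - (\<integral>x. g x \<partial>\<nu>) \<le> measure \<mu> A - measure \<nu> A"
      using 1 2 split[OF assms(1)] split[OF assms(2,3)] by simp
  qed
qed

section \<open>Integration against a measure pushed through a Markov kernel\<close>

lemma integral_bind_prob_algebra:
  fixes f :: "'b \<Rightarrow> real"
  assumes \<mu>: "\<mu> \<in> space (prob_algebra A)" and K: "K \<in> A \<rightarrow>\<^sub>M prob_algebra B"
    and f: "f \<in> borel_measurable B" "\<And>x. x \<in> space B \<Longrightarrow> \<bar>f x\<bar> \<le> c"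
  shows "(\<integral>x. f x \<partial>(\<mu> \<bind> K)) = (\<integral>x. (\<integral>y. f y \<partial>K x) \<partial>\<mu>)"
proof -
  have s[measurable_cong]: "sets \<mu> = sets A" and "prob_space \<mu>"
    using \<mu> by (auto simp: space_prob_algebra)
  interpret prob_space \<mu> by fact
  note [measurable] = K
  have K': "K \<in> \<mu> \<rightarrow>\<^sub>M subprob_algebra B"
    by (rule measurable_prob_algebraD) measurable
  have "K x \<in> space (prob_algebra B)" if "x \<in> space \<mu>" for x
    using measurable_space[OF K] that sets_eq_imp_space_eq[OF s] by auto
  then have "space (K x) = space B" "emeasure (K x) (space B) = 1" if "x \<in> space \<mu>" for x
    using that by (force simp: space_prob_algebra dest: sets_eq_imp_space_eq intro: in_space_prob_algebra)+
  then show ?thesis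
    by (intro integral_bind[OF f(1), where B=c and B'=1])
       (use K' f(2) in \<open>auto intro!: AE_I2 finite_measure_axioms\<close>)
qed

lemma measure_bind_prob_algebra:
  assumes \<mu>: "\<mu> \<in> space (prob_algebra A)" and K: "K \<in> A \<rightarrow>\<^sub>M prob_algebra B" and T: "T \<in> sets B"
  shows "measure (\<mu> \<bind> K) T = (\<integral>x. measure (K x) T \<partial>\<mu>)"
proof -
  have s[measurable_cong]: "sets \<mu> = sets A" and "prob_space \<mu>"
    using \<mu> by (auto simp: space_prob_algebra)
  interpret prob_space \<mu> by fact
  note [measurable] = K
  show ?thesis
    by (rule measure_bind[OF _ T], rule measurable_prob_algebraD) measurable
qed

lemma bind_in_prob_algebra:
  "\<mu> \<in> space (prob_algebra A) \<Longrightarrow> K \<in> A \<rightarrow>\<^sub>M prob_algebra B \<Longrightarrow> \<mu> \<bind> K \<in> space (prob_algebra B)"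
  by (simp add: space_prob_algebra[of B] prob_space_bind' sets_bind')

lemma uniform_count_measure_in_prob_algebra:
  "finite V \<Longrightarrow> V \<noteq> {} \<Longrightarrow> uniform_count_measure V \<in> space (prob_algebra (count_space V))"
  by (simp add: space_prob_algebra prob_space_uniform_count_measure sets_uniform_count_measure_count_space)

section \<open>The uniform mixture and the norm of the family\<close>

context
  fixes X :: "'x measure" and V :: "'v set" and P :: "'v \<Rightarrow> 'x measure"
  assumes V: "finite V" "V \<noteq> {}" and P: "\<And>v. v \<in> V \<Longrightarrow> P v \<in> space (prob_algebra X)"
begin

lemma family_measurable: "P \<in> count_space V \<rightarrow>\<^sub>M prob_algebra X"
  using P by auto

lemma uniform_mixture_in_prob_algebra: "uniform_mixture V P \<in> space (prob_algebra X)"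
  unfolding uniform_mixture_def
  by (rule bind_in_prob_algebra[OF uniform_count_measure_in_prob_algebra[OF V] family_measurable])

lemma integral_uniform_mixture:
  fixes f :: "'x \<Rightarrow> real"
  assumes "f \<in> borel_measurable X" "\<And>x. x \<in> space X \<Longrightarrow> \<bar>f x\<bar> \<le> c"
  shows "(\<integral>x. f x \<partial>uniform_mixture V P) = (\<Sum>v\<in>V. \<integral>x. f x \<partial>P v) / card V"
  unfolding uniform_mixture_def
  by (subst integral_bind_prob_algebra[OF uniform_count_measure_in_prob_algebra[OF V] family_measurable assms])
     (auto simp: integral_uniform_count_measure V)

lemma measure_uniform_mixture:
  "A \<in> sets X \<Longrightarrow> measure (uniform_mixture V P) A = (\<Sum>v\<in>V. measure (P v) A) / card V"
  unfolding uniform_mixture_def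
  by (subst measure_bind_prob_algebra[OF uniform_count_measure_in_prob_algebra[OF V] family_measurable])
     (auto simp: integral_uniform_count_measure V)

text \<open>The norm is a root mean square over \<open>V\<close>, whereas summing advantages
  produces a mean absolute deviation; Cauchy-Schwarz against the constant 1 compares the
  two.\<close>

lemma inf_to_2_norm_bound:
  fixes f :: "'x \<Rightarrow> real"
  assumes f: "f \<in> borel_measurable X" "\<And>x. x \<in> space X \<Longrightarrow> \<bar>f x\<bar> \<le> 1"
  shows "(\<Sum>v\<in>V. \<bar>(\<integral>x. f x \<partial>P v) - (\<integral>x. f x \<partial>uniform_mixture V P)\<bar>) / card V \<le> inf_to_2_norm X V P"
proof -
  let ?F = "{f \<in> borel_measurable X. \<forall>x\<in>space X. f x \<in> {-1..1::real}}"
  let ?d = "\<lambda>f v. (\<integral>x. f x \<partial>P v) - (\<integral>x. f x \<partial>uniform_mixture V P)"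
  let ?n = "\<lambda>f. sqrt (\<integral>v. (?d f v)\<^sup>2 \<partial>uniform_count_measure V)"
  have card: "card V > 0"
    using V by (simp add: card_gt_0_iff)
  have le1: "\<bar>\<integral>x. f x \<partial>\<mu>\<bar> \<le> 1" if "f \<in> ?F" "\<mu> \<in> space (prob_algebra X)" for f \<mu>
  proof -
    interpret prob_space \<mu> using that by (simp add: space_prob_algebra)
    have sp: "space \<mu> = space X" and s[measurable_cong]: "sets \<mu> = sets X"
      using that by (auto simp: space_prob_algebra dest: sets_eq_imp_space_eq)
    have [measurable]: "f \<in> borel_measurable X"
      using that by simp
    have "\<bar>f x\<bar> \<le> 1" if "x \<in> space \<mu>" for x
      using that \<open>f \<in> ?F\<close> sp by (force simp: abs_le_iff)
    moreover from this have "integrable \<mu> f"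
      by (intro integrable_const_bound[where B=1]) auto
    ultimately have "\<bar>\<integral>x. f x \<partial>\<mu>\<bar> \<le> (\<integral>x. 1 \<partial>\<mu>)"
      by (intro integral_abs_bound[THEN order_trans] integral_mono) auto
    then show ?thesis by (simp add: prob_space)
  qed
  \<comment> \<open>A real supremum dominates its members only for a set that is bounded above. Each
    deviation is a difference of two numbers in [-1, 1], hence the bound 2.\<close>
  have bdd: "bdd_above (?n ` ?F)"
  proof (intro bdd_aboveI[where M=2], clarify)
    fix f :: "'x \<Rightarrow> real" assume f: "f \<in> borel_measurable X" "\<forall>x\<in>space X. f x \<in> {-1..1}"
    have "(?d f v)\<^sup>2 \<le> 4" if "v \<in> V" for v
    proof -
      have "\<bar>?d f v\<bar> \<le> 2"
        using le1[of f "P v"] le1[of f "uniform_mixture V P"] P[OF that] f uniform_mixture_in_prob_algebra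
        by simp
      then show ?thesis
        using abs_le_square_iff[of "?d f v" 2] by simp
    qed
    then have "(\<Sum>v\<in>V. (?d f v)\<^sup>2) / card V \<le> (\<Sum>v\<in>V. 4) / card V"
      by (intro divide_right_mono sum_mono) auto
    then show "?n f \<le> 2"
      using card by (intro real_le_lsqrt) (auto simp: integral_uniform_count_measure V)
  qed
  have "(\<Sum>v\<in>V. \<bar>?d f v\<bar>)\<^sup>2 \<le> card V * (\<Sum>v\<in>V. (?d f v)\<^sup>2)"
    using Cauchy_Schwarz_ineq_sum[of "\<lambda>_. 1" "\<lambda>v. \<bar>?d f v\<bar>" V] by simp
  then have "((\<Sum>v\<in>V. \<bar>?d f v\<bar>) / card V)\<^sup>2 \<le> (\<Sum>v\<in>V. (?d f v)\<^sup>2) / card V"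
    using card by (simp add: power_divide field_simps power2_eq_square)
  then have "(\<Sum>v\<in>V. \<bar>?d f v\<bar>) / card V \<le> ?n f"
    by (intro real_le_rsqrt) (simp add: integral_uniform_count_measure V)
  also have "\<dots> \<le> inf_to_2_norm X V P"
    unfolding inf_to_2_norm_def using f by (intro cSUP_upper[OF _ bdd]) (auto simp: abs_le_iff minus_le_iff)
  finally show ?thesis .
qed

end

subsection \<open>Locally private kernels\<close>

lemma integrable_prob_algebra:
  fixes f :: "'a \<Rightarrow> real"
  assumes "\<mu> \<in> space (prob_algebra A)" "f \<in> borel_measurable A" "\<And>x. x \<in> space A \<Longrightarrow> \<bar>f x\<bar> \<le> c"
  shows "integrable \<mu> f"
proof -
  interpret prob_space \<mu> using assms by (simp add: space_prob_algebra)
  have sp: "space \<mu> = space A" and s[measurable_cong]: "sets \<mu> = sets A"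
    using assms by (auto simp: space_prob_algebra dest: sets_eq_imp_space_eq)
  note [measurable] = assms(2)
  show ?thesis
    by (rule integrable_const_bound[where B=c]) (use assms(3) sp in auto)
qed

lemma integral_le_const_prob_algebra:
  fixes f :: "'a \<Rightarrow> real"
  assumes "\<mu> \<in> space (prob_algebra A)" "f \<in> borel_measurable A" "\<And>x. x \<in> space A \<Longrightarrow> 0 \<le> f x \<and> f x \<le> c"
  shows "(\<integral>x. f x \<partial>\<mu>) \<le> c"
proof -
  interpret prob_space \<mu> using assms by (simp add: space_prob_algebra)
  have sp: "space \<mu> = space A"
    using assms by (auto simp: space_prob_algebra dest: sets_eq_imp_space_eq)
  have "(\<integral>x. f x \<partial>\<mu>) \<le> (\<integral>x. c \<partial>\<mu>)"
    using integrable_prob_algebra[OF assms(1,2), of c] assms(3) sp by (intro integral_mono) auto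
  then show ?thesis by (simp add: prob_space)
qed

lemma measure_preimage_finite:
  assumes "finite W" "\<sigma> \<in> S \<rightarrow>\<^sub>M count_space W" "finite_measure \<mu>" and s: "sets \<mu> = sets S" and "Z \<subseteq> W"
  shows "measure \<mu> {s\<in>space S. \<sigma> s \<in> Z} = (\<Sum>z\<in>Z. measure \<mu> {s\<in>space S. \<sigma> s = z})"
proof -
  interpret finite_measure \<mu> by fact
  have fin: "finite Z" using assms(1,5) by (rule finite_subset[rotated])
  have "measure \<mu> (\<Union>z\<in>Z. {s\<in>space S. \<sigma> s = z}) = (\<Sum>z\<in>Z. measure \<mu> {s\<in>space S. \<sigma> s = z})"
  proof (rule finite_measure_finite_Union[OF fin])
    have "{s \<in> space S. \<sigma> s = z} \<in> sets S" if "z \<in> Z" for z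
    proof -
      have "\<sigma> -` {z} \<inter> space S \<in> sets S"
        using that assms(5) by (intro measurable_sets[OF assms(2)]) auto
      also have "\<sigma> -` {z} \<inter> space S = {s \<in> space S. \<sigma> s = z}" by auto
      finally show ?thesis .
    qed
    then show "(\<lambda>z. {s \<in> space S. \<sigma> s = z}) ` Z \<subseteq> sets \<mu>"
      unfolding s by blast
    show "disjoint_family_on (\<lambda>z. {s \<in> space S. \<sigma> s = z}) Z"
      unfolding disjoint_family_on_def by blast
  qed
  also have "(\<Union>z\<in>Z. {s\<in>space S. \<sigma> s = z}) = {s\<in>space S. \<sigma> s \<in> Z}" by blast
  finally show ?thesis .
qed

section \<open>Clamping masses to the range of pure privacy\<close>

text \<open>For nonnegative \<open>\<epsilon>\<close> and \<open>u\<close> this projects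
  \<open>r\<close> onto the interval that privacy with \<delta> = 0 would allow for a cell of
  reference mass \<open>u\<close>.\<close>

definition dp_clamp :: "real \<Rightarrow> real \<Rightarrow> real \<Rightarrow> real" where
  "dp_clamp \<epsilon> u r = max (exp (- \<epsilon>) * u) (min (exp \<epsilon> * u) r)"

lemma dp_clamp_measurable[measurable]:
  "f \<in> borel_measurable M \<Longrightarrow> (\<lambda>x. dp_clamp \<epsilon> u (f x)) \<in> borel_measurable M"
  unfolding dp_clamp_def by (intro borel_measurable_max borel_measurable_min borel_measurable_const)

text \<open>The upper end of the interval is at exactly the stated distance from \<open>u\<close>.
  The lower end is no farther away, because
  \<open>1 - exp (- \<epsilon>) \<le> exp \<epsilon> - 1\<close>, which is
  \<open>cosh \<epsilon> \<ge> 1\<close>.\<close>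

lemma dp_clamp_close:
  assumes "0 \<le> \<epsilon>" "0 \<le> u"
  shows "\<bar>dp_clamp \<epsilon> u r - u\<bar> \<le> (exp \<epsilon> - 1) * u"
proof -
  have "2 \<le> exp \<epsilon> + exp (- \<epsilon>)"
    using cosh_real_ge_1[of \<epsilon>] by (simp add: cosh_def)
  then have 1: "(1 - (exp \<epsilon> - 1)) * u \<le> exp (- \<epsilon>) * u"
    using assms by (intro mult_right_mono) auto
  have 2: "exp (- \<epsilon>) * u \<le> exp \<epsilon> * u"
    using assms by (intro mult_right_mono) auto
  have "exp (- \<epsilon>) * u \<le> dp_clamp \<epsilon> u r" "dp_clamp \<epsilon> u r \<le> exp \<epsilon> * u"
    unfolding dp_clamp_def using 2 by auto
  then show ?thesis using 1 by (auto simp: abs_le_iff algebra_simps)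
qed

text \<open>Clamping changes \<open>r\<close> only where it exceeds the upper end or falls short of
  the lower end. The total excess is the slack in \<open>ru\<close> for the set \<open>?A\<close> of
  all offending cells at once, and the total shortfall is at most the slack in \<open>ur\<close> for
  \<open>?B\<close>; so each costs one \<delta>, however many cells there are.\<close>

lemma sum_dp_clamp_error:
  fixes r u :: "'w \<Rightarrow> real"
  assumes W: "finite W" and \<epsilon>: "0 \<le> \<epsilon>" and u: "\<And>z. z \<in> W \<Longrightarrow> 0 \<le> u z"
    and ru: "\<And>Z. Z \<subseteq> W \<Longrightarrow> sum r Z \<le> exp \<epsilon> * sum u Z + \<delta>"
    and ur: "\<And>Z. Z \<subseteq> W \<Longrightarrow> sum u Z \<le> exp \<epsilon> * sum r Z + \<delta>"
  shows "(\<Sum>z\<in>W. \<bar>r z - dp_clamp \<epsilon> (u z) (r z)\<bar>) \<le> 2 * \<delta>"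
proof -
  have \<delta>: "0 \<le> \<delta>" using ru[of "{}"] by simp
  let ?A = "{z\<in>W. r z > exp \<epsilon> * u z}" and ?B = "{z\<in>W. r z < exp (- \<epsilon>) * u z}"
  have le: "exp (- \<epsilon>) * u z \<le> exp \<epsilon> * u z" if "z \<in> W" for z
    using \<epsilon> u[OF that] by (intro mult_right_mono) auto
  have "\<bar>r z - dp_clamp \<epsilon> (u z) (r z)\<bar> = (if r z > exp \<epsilon> * u z then r z - exp \<epsilon> * u z else 0) +
      (if r z < exp (- \<epsilon>) * u z then exp (- \<epsilon>) * u z - r z else 0)" if "z \<in> W" for z
    using le[OF that] unfolding dp_clamp_def by (auto simp: max_def min_def)
  then have "(\<Sum>z\<in>W. \<bar>r z - dp_clamp \<epsilon> (u z) (r z)\<bar>) =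
      (\<Sum>z\<in>?A. r z - exp \<epsilon> * u z) + (\<Sum>z\<in>?B. exp (- \<epsilon>) * u z - r z)"
    using W by (simp add: sum.distrib sum.inter_filter)
  also have "(\<Sum>z\<in>?A. r z - exp \<epsilon> * u z) \<le> \<delta>"
    using ru[of ?A] by (simp add: sum_subtractf sum_distrib_left)
  \<comment> \<open>Pulling out \<open>exp (- \<epsilon>)\<close> leaves the very difference that
    \<open>ur\<close> bounds.\<close>
  also have "(\<Sum>z\<in>?B. exp (- \<epsilon>) * u z - r z) = exp (- \<epsilon>) * (sum u ?B - exp \<epsilon> * sum r ?B)"
    unfolding sum_distrib_left sum_subtractf[symmetric] by (simp add: exp_minus field_simps)
  also have "\<dots> \<le> exp (- \<epsilon>) * \<delta>"
    using ur[of ?B] by (intro mult_left_mono) auto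
  also have "\<dots> \<le> \<delta>"
    using \<epsilon> \<delta> by (intro mult_left_le_one_le) auto
  finally show ?thesis by simp
qed

text \<open>The sets \<open>A v\<close> cut \<open>S\<close> into finitely many cells. On each cell the density of \<open>K x\<close> relative to
  its \<open>U\<close>-average lies in \<open>[exp (-\<epsilon>), exp \<epsilon>]\<close> once clamped, so after rescaling it is a
  test function for the norm; privacy bounds the total clamping error by \<open>2 * \<delta>\<close>.\<close>

lemma locally_private_kernel_bound:
  assumes V: "finite V" "V \<noteq> {}" and P: "\<And>v. v \<in> V \<Longrightarrow> P v \<in> space (prob_algebra X)"
    and K: "K \<in> X \<rightarrow>\<^sub>M prob_algebra S" and A: "\<And>v. v \<in> V \<Longrightarrow> A v \<in> sets S" and \<epsilon>: "0 \<le> \<epsilon>"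
    and dp: "\<And>x x' T. x \<in> space X \<Longrightarrow> x' \<in> space X \<Longrightarrow> T \<in> sets S \<Longrightarrow>
      measure (K x) T \<le> exp \<epsilon> * measure (K x') T + \<delta>"
  shows "(\<Sum>v\<in>V. measure (P v \<bind> K) (A v) - measure (uniform_mixture V P \<bind> K) (A v)) / card V
    \<le> (exp \<epsilon> - 1) * inf_to_2_norm X V P + 4 * \<delta>"
proof -
  define U where "U = uniform_mixture V P"
  define N where "N = inf_to_2_norm X V P"
  define a where "a = exp \<epsilon> - 1"
  define u where "u T = measure (U \<bind> K) T" for T
  \<comment> \<open>A point is labelled by the set of all \<open>v\<close> with the point in
    \<open>A v\<close>. There are finitely many labels, and each \<open>A v\<close> is the union of
    the cells whose label contains \<open>v\<close>.\<close>
  define W where "W = Pow V"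
  define \<sigma> where "\<sigma> s = {v\<in>V. s \<in> A v}" for s
  define cell where "cell z = {s\<in>space S. \<sigma> s = z}" for z
  define r where "r z x = measure (K x) (cell z)" for z x
  define c where "c z x = dp_clamp \<epsilon> (u (cell z)) (r z x)" for z x
  define f where "f z x = (c z x - u (cell z)) / (a * u (cell z))" for z x
  define \<Delta> where "\<Delta> v h = (\<integral>x. h x \<partial>P v) - (\<integral>x. h x \<partial>U)" for v and h :: "_ \<Rightarrow> real"
  have a: "0 \<le> a" using \<epsilon> by (simp add: a_def)
  have card: "card V > 0" using V by (simp add: card_gt_0_iff)
  have W: "finite W" using V by (simp add: W_def)
  have U: "U \<in> space (prob_algebra X)"
    unfolding U_def by (rule uniform_mixture_in_prob_algebra[OF V P])
  have UK: "U \<bind> K \<in> space (prob_algebra S)"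
    by (rule bind_in_prob_algebra[OF U K])
  have kx: "K x \<in> space (prob_algebra S)" if "x \<in> space X" for x
    using measurable_space[OF K that] .
  have rmeas: "(\<lambda>x. measure (K x) T) \<in> borel_measurable X" if "T \<in> sets S" for T
    by (rule measurable_compose[OF K measurable_measure_prob_algebra[OF that]])
  have rbound: "0 \<le> measure (K x) T \<and> measure (K x) T \<le> 1" if "x \<in> space X" for x T
    using kx[OF that] by (auto simp: space_prob_algebra intro: prob_space.prob_le_1)
  have u_int: "u T = (\<integral>x. measure (K x) T \<partial>U)" if "T \<in> sets S" for T
    unfolding u_def by (rule measure_bind_prob_algebra[OF U K that])
  have \<sigma>: "\<sigma> \<in> S \<rightarrow>\<^sub>M count_space W"
  proof (rule measurable_count_space_eq2[THEN iffD2, OF W], safe)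
    show "\<sigma> s \<in> W" for s by (auto simp: \<sigma>_def W_def)
    fix z assume z: "z \<in> W"
    have "\<sigma> s = z \<longleftrightarrow> (\<forall>v\<in>V. s \<in> A v \<longleftrightarrow> v \<in> z)" for s
      using z unfolding \<sigma>_def W_def by blast
    then have "\<sigma> -` {z} \<inter> space S = {s\<in>space S. \<forall>v\<in>V. s \<in> A v \<longleftrightarrow> v \<in> z}"
      by (simp only: vimage_def) blast
    also have "\<dots> \<in> sets S"
    proof (rule sets.sets_Collect_finite_All'[OF _ V(1,2)])
      fix v assume "v \<in> V"
      then have "(if v \<in> z then A v else space S - A v) \<in> sets S"
        using A by auto
      also have "(if v \<in> z then A v else space S - A v) = {s\<in>space S. s \<in> A v \<longleftrightarrow> v \<in> z}"
        using sets.sets_into_space[OF A[OF \<open>v \<in> V\<close>]] by auto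
      finally show "{s\<in>space S. s \<in> A v \<longleftrightarrow> v \<in> z} \<in> sets S" .
    qed
    finally show "\<sigma> -` {z} \<inter> space S \<in> sets S" .
  qed
  have cell: "cell z \<in> sets S" if "z \<in> W" for z
  proof -
    have "\<sigma> -` {z} \<inter> space S \<in> sets S"
      using that by (intro measurable_sets[OF \<sigma>]) auto
    also have "\<sigma> -` {z} \<inter> space S = cell z" by (auto simp: cell_def)
    finally show ?thesis .
  qed
  have split: "measure \<mu> {s\<in>space S. \<sigma> s \<in> Z} = (\<Sum>z\<in>Z. measure \<mu> (cell z))"
    if "\<mu> \<in> space (prob_algebra S)" "Z \<subseteq> W" for \<mu> Z
    unfolding cell_def using that
    by (intro measure_preimage_finite[OF W \<sigma>]) (auto simp: space_prob_algebra prob_space_def)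
  have union: "{s\<in>space S. \<sigma> s \<in> Z} \<in> sets S" if "Z \<subseteq> W" for Z
  proof -
    have "\<sigma> -` Z \<inter> space S \<in> sets S"
      using that by (intro measurable_sets[OF \<sigma>]) auto
    also have "\<sigma> -` Z \<inter> space S = {s\<in>space S. \<sigma> s \<in> Z}" by auto
    finally show ?thesis .
  qed
  have Upr: "prob_space U" and Usp: "space U = space X"
    using U by (auto simp: space_prob_algebra dest: sets_eq_imp_space_eq)
  have int_r: "integrable U (\<lambda>x. measure (K x) T)" if "T \<in> sets S" for T
    by (rule integrable_prob_algebra[OF U rmeas[OF that], of 1]) (use rbound in auto)
  \<comment> \<open>Averaging the privacy inequality over \<open>x'\<close> drawn from
    \<open>U\<close> compares \<open>K x\<close> with the mixture \<open>U \<bind> K\<close> itself;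
    \<open>u_le\<close> does the same in the other direction.\<close>
  have le_u: "measure (K x) T \<le> exp \<epsilon> * u T + \<delta>" if "x \<in> space X" "T \<in> sets S" for x T
  proof -
    interpret prob_space U by fact
    have "(\<integral>x'. measure (K x) T \<partial>U) \<le> (\<integral>x'. exp \<epsilon> * measure (K x') T + \<delta> \<partial>U)"
      using int_r that dp by (intro integral_mono) (auto simp: Usp)
    then show ?thesis
      using int_r that by (simp add: u_int prob_space)
  qed
  have u_le: "u T \<le> exp \<epsilon> * measure (K x) T + \<delta>" if "x \<in> space X" "T \<in> sets S" for x T
  proof -
    interpret prob_space U by fact
    have "(\<integral>x'. measure (K x') T \<partial>U) \<le> (\<integral>x'. exp \<epsilon> * measure (K x) T + \<delta> \<partial>U)"
      using int_r that dp by (intro integral_mono) (auto simp: Usp)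
    then show ?thesis
      using int_r that by (simp add: u_int prob_space)
  qed
  have u0: "0 \<le> u T" for T by (simp add: u_def)
  \<comment> \<open>A sum over a set of labels is the mass of one measurable union of cells, so
    privacy for events becomes the hypotheses on all \<open>Z\<close> in the clamping lemma.\<close>
  have err: "(\<Sum>z\<in>W. \<bar>r z x - c z x\<bar>) \<le> 2 * \<delta>" if x: "x \<in> space X" for x
    unfolding c_def
  proof (rule sum_dp_clamp_error[OF W \<epsilon> u0])
    fix Z assume Z: "Z \<subseteq> W"
    have sr: "(\<Sum>z\<in>Z. r z x) = measure (K x) {s\<in>space S. \<sigma> s \<in> Z}"
      unfolding r_def using split[OF kx[OF x] Z] by simp
    have su: "(\<Sum>z\<in>Z. u (cell z)) = u {s\<in>space S. \<sigma> s \<in> Z}"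
      unfolding u_def using split[OF UK Z] by simp
    show "(\<Sum>z\<in>Z. r z x) \<le> exp \<epsilon> * (\<Sum>z\<in>Z. u (cell z)) + \<delta>"
      and "(\<Sum>z\<in>Z. u (cell z)) \<le> exp \<epsilon> * (\<Sum>z\<in>Z. r z x) + \<delta>"
      using le_u[OF x union[OF Z]] u_le[OF x union[OF Z]] by (simp_all add: sr su)
  qed
  have close: "\<bar>c z x - u (cell z)\<bar> \<le> a * u (cell z)" for z x
    unfolding c_def a_def by (rule dp_clamp_close[OF \<epsilon> u0])
  have f1: "\<bar>f z x\<bar> \<le> 1" for z x
    using close[of z x] mult_nonneg_nonneg[OF a u0[of "cell z"]]
    by (auto simp: f_def divide_le_eq_1)
  \<comment> \<open>If \<open>a * u (cell z)\<close> is zero, division makes \<open>f z x\<close>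
    zero while \<open>close\<close> forces \<open>c z x = u (cell z)\<close>, so the identity
    survives.\<close>
  have cf: "c z x = u (cell z) + a * u (cell z) * f z x" for z x
    using close[of z x] by (auto simp: f_def)
  have rm: "r z \<in> borel_measurable X" if "z \<in> W" for z
    unfolding r_def by (rule rmeas[OF cell[OF that]])
  have cm: "c z \<in> borel_measurable X" if "z \<in> W" for z
    unfolding c_def using rm[OF that] by measurable
  have fm: "f z \<in> borel_measurable X" if "z \<in> W" for z
    unfolding f_def using cm[OF that] by measurable
  have em: "(\<lambda>x. \<bar>r z x - c z x\<bar>) \<in> borel_measurable X" if "z \<in> W" for z
    using rm[OF that] cm[OF that] by measurable
  have e_le: "\<bar>r z x - c z x\<bar> \<le> 2 * \<delta>" if "z \<in> W" "x \<in> space X" for z x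
    using member_le_sum[of z W "\<lambda>z. \<bar>r z x - c z x\<bar>"] err[OF that(2)] that W by simp
  have error: "(\<Sum>z\<in>W. \<integral>x. \<bar>r z x - c z x\<bar> \<partial>\<mu>) \<le> 2 * \<delta>"
    and error_int: "\<And>z. z \<in> W \<Longrightarrow> integrable \<mu> (\<lambda>x. r z x - c z x)"
    if \<mu>: "\<mu> \<in> space (prob_algebra X)" for \<mu>
  proof -
    have i: "integrable \<mu> (\<lambda>x. \<bar>r z x - c z x\<bar>)" if "z \<in> W" for z
      using integrable_prob_algebra[OF \<mu> em[OF that], of "2 * \<delta>"] e_le[OF that] by simp
    then have "(\<Sum>z\<in>W. \<integral>x. \<bar>r z x - c z x\<bar> \<partial>\<mu>) = (\<integral>x. (\<Sum>z\<in>W. \<bar>r z x - c z x\<bar>) \<partial>\<mu>)"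
      by simp
    also have "\<dots> \<le> 2 * \<delta>"
      by (rule integral_le_const_prob_algebra[OF \<mu>]) (use em err in \<open>auto intro: sum_nonneg\<close>)
    finally show "(\<Sum>z\<in>W. \<integral>x. \<bar>r z x - c z x\<bar> \<partial>\<mu>) \<le> 2 * \<delta>" .
    show "integrable \<mu> (\<lambda>x. r z x - c z x)" if "z \<in> W" for z
      by (rule integrable_prob_algebra[OF \<mu>, of _ "2 * \<delta>"]) (use rm cm e_le that in auto)
  qed
  have f_int: "integrable \<mu> (f z)" if "\<mu> \<in> space (prob_algebra X)" "z \<in> W" for \<mu> z
    by (rule integrable_prob_algebra[OF that(1) fm[OF that(2)] f1])
  \<comment> \<open>On each cell, \<open>r\<close> is clamping error plus a constant plus a multiple
    of the test function \<open>f z\<close>. The constant cancels between \<open>P v\<close> and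
    \<open>U\<close>, and the error costs \<open>2 * \<delta>\<close> under each of these two
    distributions.\<close>
  have single: "measure (P v \<bind> K) (A v) - u (A v) \<le> 4 * \<delta> + a * (\<Sum>z\<in>W. u (cell z) * \<bar>\<Delta> v (f z)\<bar>)"
    if v: "v \<in> V" for v
  proof -
    note Pv = P[OF v]
    define Z where "Z = {z\<in>W. v \<in> z}"
    have ZW: "Z \<subseteq> W" by (auto simp: Z_def)
    have "A v = {s\<in>space S. \<sigma> s \<in> Z}"
      using v sets.sets_into_space[OF A[OF v]] by (auto simp: Z_def W_def \<sigma>_def)
    then have Asum: "measure \<mu> (A v) = (\<Sum>z\<in>Z. measure \<mu> (cell z))" if "\<mu> \<in> space (prob_algebra S)" for \<mu>
      using split[OF that ZW] by simp
    have int_rz: "(\<integral>x. r z x \<partial>\<mu>) = (\<integral>x. r z x - c z x \<partial>\<mu>) + u (cell z) + a * u (cell z) * (\<integral>x. f z x \<partial>\<mu>)"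
      if \<mu>: "\<mu> \<in> space (prob_algebra X)" and z: "z \<in> W" for \<mu> z
    proof -
      interpret prob_space \<mu> using \<mu> by (simp add: space_prob_algebra)
      have "(\<integral>x. r z x \<partial>\<mu>) = (\<integral>x. (r z x - c z x) + (u (cell z) + a * u (cell z) * f z x) \<partial>\<mu>)"
        by (simp add: cf)
      also have "\<dots> = (\<integral>x. r z x - c z x \<partial>\<mu>) + (\<integral>x. u (cell z) + a * u (cell z) * f z x \<partial>\<mu>)"
        using error_int[OF \<mu> z] f_int[OF \<mu> z] by (intro Bochner_Integration.integral_add) auto
      also have "(\<integral>x. u (cell z) + a * u (cell z) * f z x \<partial>\<mu>) = u (cell z) + a * u (cell z) * (\<integral>x. f z x \<partial>\<mu>)"
        using f_int[OF \<mu> z] by (simp add: prob_space)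
      finally show ?thesis by simp
    qed
    have "measure (P v \<bind> K) (A v) - u (A v) =
        (\<Sum>z\<in>Z. measure (P v \<bind> K) (cell z) - measure (U \<bind> K) (cell z))"
      unfolding u_def using Asum[OF bind_in_prob_algebra[OF Pv K]] Asum[OF UK]
      by (simp add: sum_subtractf)
    also have "\<dots> = (\<Sum>z\<in>Z. (\<integral>x. r z x \<partial>P v) - (\<integral>x. r z x \<partial>U))"
      using cell ZW by (intro sum.cong)
        (auto simp: r_def measure_bind_prob_algebra[OF Pv K] measure_bind_prob_algebra[OF U K])
    also have "\<dots> \<le> (\<Sum>z\<in>Z. (\<integral>x. \<bar>r z x - c z x\<bar> \<partial>P v) + (\<integral>x. \<bar>r z x - c z x\<bar> \<partial>U)
        + a * (u (cell z) * \<bar>\<Delta> v (f z)\<bar>))"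
    proof (rule sum_mono)
      fix z assume "z \<in> Z"
      then have z: "z \<in> W" using ZW by auto
      have "(\<integral>x. r z x \<partial>P v) - (\<integral>x. r z x \<partial>U) =
          (\<integral>x. r z x - c z x \<partial>P v) - (\<integral>x. r z x - c z x \<partial>U) + a * u (cell z) * \<Delta> v (f z)"
        unfolding int_rz[OF Pv z] int_rz[OF U z] \<Delta>_def by (simp add: algebra_simps)
      moreover have "(\<integral>x. r z x - c z x \<partial>P v) \<le> (\<integral>x. \<bar>r z x - c z x\<bar> \<partial>P v)"
        and "- (\<integral>x. r z x - c z x \<partial>U) \<le> (\<integral>x. \<bar>r z x - c z x\<bar> \<partial>U)"
        using integral_abs_bound[of "P v" "\<lambda>x. r z x - c z x"]
          integral_abs_bound[of U "\<lambda>x. r z x - c z x"] by linarith+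
      moreover have "a * u (cell z) * \<Delta> v (f z) \<le> a * u (cell z) * \<bar>\<Delta> v (f z)\<bar>"
        using a u0 by (intro mult_left_mono) auto
      ultimately show "(\<integral>x. r z x \<partial>P v) - (\<integral>x. r z x \<partial>U) \<le>
          (\<integral>x. \<bar>r z x - c z x\<bar> \<partial>P v) + (\<integral>x. \<bar>r z x - c z x\<bar> \<partial>U) + a * (u (cell z) * \<bar>\<Delta> v (f z)\<bar>)"
        by (simp add: mult.assoc)
    qed
    \<comment> \<open>The summands are nonnegative, so the cells inside \<open>A v\<close> may be
      enlarged to all cells. The index set then no longer depends on \<open>v\<close>, which permits
      exchanging the sums over \<open>v\<close> and \<open>z\<close>.\<close>
    also have "\<dots> \<le> (\<Sum>z\<in>W. (\<integral>x. \<bar>r z x - c z x\<bar> \<partial>P v) + (\<integral>x. \<bar>r z x - c z x\<bar> \<partial>U)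
        + a * (u (cell z) * \<bar>\<Delta> v (f z)\<bar>))"
      by (intro sum_mono2 W ZW add_nonneg_nonneg mult_nonneg_nonneg a u0 Bochner_Integration.integral_nonneg) auto
    also have "\<dots> \<le> 4 * \<delta> + a * (\<Sum>z\<in>W. u (cell z) * \<bar>\<Delta> v (f z)\<bar>)"
      using error[OF Pv] error[OF U] by (simp add: sum.distrib sum_distrib_left)
    finally show ?thesis .
  qed
  have "(\<Sum>v\<in>V. measure (P v \<bind> K) (A v) - u (A v)) / card V
      \<le> (\<Sum>v\<in>V. 4 * \<delta> + a * (\<Sum>z\<in>W. u (cell z) * \<bar>\<Delta> v (f z)\<bar>)) / card V"
    by (intro divide_right_mono sum_mono single) auto
  also have "\<dots> = 4 * \<delta> + a * ((\<Sum>v\<in>V. \<Sum>z\<in>W. u (cell z) * \<bar>\<Delta> v (f z)\<bar>) / card V)"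
    using card by (simp add: sum.distrib sum_distrib_left add_divide_distrib)
  \<comment> \<open>For a fixed cell, the average over \<open>v\<close> is that of the single test
    function \<open>f z\<close>, hence at most the norm. The weights \<open>u (cell z)\<close> sum
    to 1, so the number of cells does not enter the bound.\<close>
  also have "(\<Sum>v\<in>V. \<Sum>z\<in>W. u (cell z) * \<bar>\<Delta> v (f z)\<bar>) / card V
      = (\<Sum>z\<in>W. u (cell z) * ((\<Sum>v\<in>V. \<bar>\<Delta> v (f z)\<bar>) / card V))"
    by (subst sum.swap) (simp add: sum_distrib_left sum_divide_distrib)
  also have "\<dots> \<le> (\<Sum>z\<in>W. u (cell z) * N)"
    unfolding N_def \<Delta>_def U_def
    by (intro sum_mono mult_left_mono inf_to_2_norm_bound[OF V P] u0 fm f1)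
  also have "\<dots> = u {s\<in>space S. \<sigma> s \<in> W} * N"
    using split[OF UK, of W] by (simp add: u_def sum_distrib_right)
  also have "{s\<in>space S. \<sigma> s \<in> W} = space (U \<bind> K)"
    using UK by (auto simp: \<sigma>_def W_def space_prob_algebra dest: sets_eq_imp_space_eq)
  also have "u (space (U \<bind> K)) = 1"
    using UK by (simp add: u_def space_prob_algebra prob_space.prob_space)
  finally show ?thesis
    using a by (simp add: u_def U_def N_def a_def mult_left_mono)
qed

subsection \<open>Splicing product measures\<close>

lemma prob_algebra_PiM:
  assumes "\<And>i. i \<in> I \<Longrightarrow> D i \<in> space (prob_algebra (X i))"
  shows "PiM I D \<in> space (prob_algebra (PiM I X))"
proof -
  have "sets (PiM I D) = sets (PiM I X)"
    using assms by (intro sets_PiM_cong) (auto simp: space_prob_algebra)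
  moreover have "prob_space (PiM I D)"
    using assms by (intro prob_space_PiM) (auto simp: space_prob_algebra)
  ultimately show ?thesis by (simp add: space_prob_algebra)
qed

lemma prob_algebra_iid:
  "D \<in> space (prob_algebra X) \<Longrightarrow> iid n D \<in> space (prob_algebra (PiM {1..n} (\<lambda>_. X)))"
  unfolding iid_def by (rule prob_algebra_PiM)

lemma vimage_Times3:
  assumes "\<And>x y z. y \<in> SY \<Longrightarrow> z \<in> SZ \<Longrightarrow> x \<in> A \<and> y \<in> B \<and> z \<in> C \<longleftrightarrow> g x y z \<in> E"
    and "A \<subseteq> SX" "B \<subseteq> SY" "C \<subseteq> SZ"
  shows "(\<lambda>(x, y, z). g x y z) -` E \<inter> (SX \<times> SY \<times> SZ) = A \<times> B \<times> C"
  using assms(2-) by (auto simp: assms(1)[symmetric] subset_iff)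

text \<open>Taking whole streams for \<open>y\<close> and \<open>z\<close> lets both be sampled from
  \<open>iid n\<close>, with no special case for \<open>t = 1\<close> or
  \<open>t = n\<close>.\<close>

definition splice_at :: "nat \<Rightarrow> nat \<Rightarrow> 'x \<Rightarrow> (nat \<Rightarrow> 'x) \<Rightarrow> (nat \<Rightarrow> 'x) \<Rightarrow> nat \<Rightarrow> 'x" where
  "splice_at n t x y z = (\<lambda>i\<in>{1..n}. if i < t then y i else if i = t then x else z i)"

lemma splice_at_measurable:
  "(\<lambda>(x, y, z). splice_at n t x y z) \<in>
     X \<Otimes>\<^sub>M PiM {1..n} (\<lambda>_. X) \<Otimes>\<^sub>M PiM {1..n} (\<lambda>_. X) \<rightarrow>\<^sub>M PiM {1..n} (\<lambda>_. X)"
  unfolding splice_at_def split_beta'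
proof (rule measurable_restrict)
  fix i assume "i \<in> {1..n}"
  then have [measurable]: "(\<lambda>x. x i) \<in> PiM {1..n} (\<lambda>_. X) \<rightarrow>\<^sub>M X"
    by (rule measurable_component_singleton)
  show "(\<lambda>p. if i < t then fst (snd p) i else if i = t then fst p else snd (snd p) i)
      \<in> X \<Otimes>\<^sub>M PiM {1..n} (\<lambda>_. X) \<Otimes>\<^sub>M PiM {1..n} (\<lambda>_. X) \<rightarrow>\<^sub>M X"
    by measurable
qed

text \<open>It suffices to compare the measures on boxes. The preimage of a box under splicing is a
  product of a set and two boxes, so both sides become products over the coordinates.\<close>

lemma distr_splice_at:
  assumes D: "D \<in> space (prob_algebra X)" and Q: "Q \<in> space (prob_algebra X)"
    and R: "R \<in> space (prob_algebra X)" and t: "t \<in> {1..n}"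
  shows "distr (Q \<Otimes>\<^sub>M iid n D \<Otimes>\<^sub>M iid n R) (PiM {1..n} (\<lambda>_. X)) (\<lambda>(x, y, z). splice_at n t x y z)
    = PiM {1..n} (\<lambda>i. if i < t then D else if i = t then Q else R)"
    (is "?L = PiM _ ?H")
proof -
  have H: "?H i \<in> space (prob_algebra X)" for i
    using D Q R by simp
  have setsH: "sets (?H i) = sets X" and prH: "prob_space (?H i)" for i
    using H[of i] by (auto simp: space_prob_algebra)
  interpret D: prob_space D using D by (simp add: space_prob_algebra)
  interpret Q: prob_space Q using Q by (simp add: space_prob_algebra)
  interpret R: prob_space R using R by (simp add: space_prob_algebra)
  have sets: "sets D = sets X" "sets Q = sets X" "sets R = sets X"
    using D Q R by (auto simp: space_prob_algebra)
  note sp = this[THEN sets_eq_imp_space_eq]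
  have [measurable_cong]: "sets (iid n D) = sets (PiM {1..n} (\<lambda>_. X))"
    "sets (iid n R) = sets (PiM {1..n} (\<lambda>_. X))" "sets Q = sets X"
    using prob_algebra_iid[OF D, of n] prob_algebra_iid[OF R, of n] sets by (auto simp: space_prob_algebra)
  note iid_sets = this
  interpret iD: prob_space "iid n D" using prob_algebra_iid[OF D, of n] by (simp add: space_prob_algebra)
  interpret iR: prob_space "iid n R" using prob_algebra_iid[OF R, of n] by (simp add: space_prob_algebra)
  interpret pDR: pair_prob_space "iid n D" "iid n R" ..
  interpret H: product_prob_space ?H "{1..n}"
    by (unfold product_prob_space_def product_sigma_finite_def product_prob_space_axioms_def)
       (use prH prob_space_imp_sigma_finite in blast)
  interpret PD: product_sigma_finite "\<lambda>_::nat. D" by standard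
  interpret PR: product_sigma_finite "\<lambda>_::nat. R" by standard
  have meas: "(\<lambda>(x, y, z). splice_at n t x y z) \<in> Q \<Otimes>\<^sub>M iid n D \<Otimes>\<^sub>M iid n R \<rightarrow>\<^sub>M PiM {1..n} (\<lambda>_. X)"
    using splice_at_measurable[of n t X] iid_sets by (simp cong: measurable_cong_sets sets_pair_measure_cong)
  show ?thesis
  proof (rule H.PiM_eqI)
    show "sets ?L = sets (PiM {1..n} ?H)"
      using setsH by (simp cong: sets_PiM_cong)
    fix A assume "\<And>i. i \<in> {1..n} \<Longrightarrow> A i \<in> sets (?H i)"
    then have A: "A i \<in> sets X" if "i \<in> {1..n}" for i
      using that setsH by blast
    \<comment> \<open>Coordinates that splicing does not take from \<open>y\<close> or
      \<open>z\<close> are left unconstrained; since \<open>D\<close> and \<open>R\<close> are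
      probability measures, they contribute the factor 1.\<close>
    define B where "B i = (if i < t then A i else space X)" for i
    define C where "C i = (if t < i then A i else space X)" for i
    have BC: "B i \<in> sets X" "C i \<in> sets X" if "i \<in> {1..n}" for i
      using A[OF that] by (auto simp: B_def C_def)
    have iff: "x \<in> A t \<and> y \<in> Pi\<^sub>E {1..n} B \<and> z \<in> Pi\<^sub>E {1..n} C \<longleftrightarrow> splice_at n t x y z \<in> Pi\<^sub>E {1..n} A"
      if y: "y \<in> {1..n} \<rightarrow>\<^sub>E space X" and z: "z \<in> {1..n} \<rightarrow>\<^sub>E space X" for x y z
    proof
      assume "x \<in> A t \<and> y \<in> Pi\<^sub>E {1..n} B \<and> z \<in> Pi\<^sub>E {1..n} C"
      then have "x \<in> A t" and B: "\<And>i. i \<in> {1..n} \<Longrightarrow> y i \<in> B i" and C: "\<And>i. i \<in> {1..n} \<Longrightarrow> z i \<in> C i"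
        by (auto dest: PiE_mem)
      then have "(if i < t then y i else if i = t then x else z i) \<in> A i" if "i \<in> {1..n}" for i
        using B[OF that] C[OF that] by (auto simp: B_def C_def)
      then show "splice_at n t x y z \<in> Pi\<^sub>E {1..n} A"
        unfolding splice_at_def by (intro restrict_PiE_iff[THEN iffD2] ballI) auto
    next
      assume "splice_at n t x y z \<in> Pi\<^sub>E {1..n} A"
      then have *: "(if i < t then y i else if i = t then x else z i) \<in> A i" if "i \<in> {1..n}" for i
        using that unfolding splice_at_def restrict_PiE_iff by blast
      have "y i \<in> B i" "z i \<in> C i" if "i \<in> {1..n}" for i
        using *[OF that] PiE_mem[OF y that] PiE_mem[OF z that] by (auto simp: B_def C_def split: if_splits)
      then show "x \<in> A t \<and> y \<in> Pi\<^sub>E {1..n} B \<and> z \<in> Pi\<^sub>E {1..n} C"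
        using *[OF t] y z by (auto simp: PiE_iff)
    qed
    have sub: "Pi\<^sub>E {1..n} B \<subseteq> {1..n} \<rightarrow>\<^sub>E space X" "Pi\<^sub>E {1..n} C \<subseteq> {1..n} \<rightarrow>\<^sub>E space X" "A t \<subseteq> space X"
      using BC A[OF t] by (intro PiE_mono sets.sets_into_space; simp)+
    have "space (Q \<Otimes>\<^sub>M iid n D \<Otimes>\<^sub>M iid n R) =
        space X \<times> ({1..n} \<rightarrow>\<^sub>E space X) \<times> ({1..n} \<rightarrow>\<^sub>E space X)"
      by (simp add: space_pair_measure iid_def space_PiM sp)
    then have vim: "(\<lambda>(x, y, z). splice_at n t x y z) -` Pi\<^sub>E {1..n} A \<inter> space (Q \<Otimes>\<^sub>M iid n D \<Otimes>\<^sub>M iid n R)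
        = A t \<times> Pi\<^sub>E {1..n} B \<times> Pi\<^sub>E {1..n} C"
      using vimage_Times3[OF iff sub(3,1,2)] by simp
    have "emeasure ?L (Pi\<^sub>E {1..n} A) = emeasure (Q \<Otimes>\<^sub>M iid n D \<Otimes>\<^sub>M iid n R) (A t \<times> Pi\<^sub>E {1..n} B \<times> Pi\<^sub>E {1..n} C)"
      unfolding vim[symmetric] using A by (intro emeasure_distr[OF meas] sets_PiM_I_finite) auto
    also have "\<dots> = emeasure Q (A t) * (emeasure (iid n D) (Pi\<^sub>E {1..n} B) * emeasure (iid n R) (Pi\<^sub>E {1..n} C))"
    proof -
      have B: "Pi\<^sub>E {1..n} B \<in> sets (iid n D)" and C: "Pi\<^sub>E {1..n} C \<in> sets (iid n R)"
        using BC by (auto simp: iid_sets intro!: sets_PiM_I_finite)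
      have "A t \<in> sets Q"
        using A[OF t] sets by simp
      then show ?thesis
        using B C by (simp add: pDR.emeasure_pair_measure_Times iR.emeasure_pair_measure_Times)
    qed
    also have "emeasure (iid n D) (Pi\<^sub>E {1..n} B) = (\<Prod>i\<in>{1..n}. emeasure D (B i))"
      unfolding iid_def using BC sets by (intro PD.emeasure_PiM) auto
    also have "emeasure (iid n R) (Pi\<^sub>E {1..n} C) = (\<Prod>i\<in>{1..n}. emeasure R (C i))"
      unfolding iid_def using BC sets by (intro PR.emeasure_PiM) auto
    \<comment> \<open>Padding the single factor of \<open>Q\<close> with ones makes all three
      factors products over \<open>{1..n}\<close>, which \<open>prod.distrib\<close> merges.\<close>
    also have "emeasure Q (A t) = (\<Prod>i\<in>{1..n}. if i = t then emeasure Q (A i) else 1)"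
      using t by simp
    also have "(\<Prod>i\<in>{1..n}. if i = t then emeasure Q (A i) else 1) *
        ((\<Prod>i\<in>{1..n}. emeasure D (B i)) * (\<Prod>i\<in>{1..n}. emeasure R (C i))) =
        (\<Prod>i\<in>{1..n}. (if i = t then emeasure Q (A i) else 1) * (emeasure D (B i) * emeasure R (C i)))"
      by (simp only: prod.distrib)
    also have "\<dots> = (\<Prod>i\<in>{1..n}. emeasure (?H i) (A i))"
      using D.emeasure_space_1 R.emeasure_space_1 sp by (intro prod.cong) (auto simp: B_def C_def)
    finally show "emeasure ?L (Pi\<^sub>E {1..n} A) = (\<Prod>i\<in>{1..n}. emeasure (?H i) (A i))" .
  qed simp
qed

text \<open>This is the change of variables along splicing followed by Fubini, with integrability
  supplied by the bound on \<open>F\<close>. It exposes past, current sample and future as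
  independent sources.\<close>

lemma integral_splice_at:
  fixes F :: "(nat \<Rightarrow> 'x) \<Rightarrow> real"
  assumes D: "D \<in> space (prob_algebra X)" and Q: "Q \<in> space (prob_algebra X)"
    and R: "R \<in> space (prob_algebra X)" and t: "t \<in> {1..n}"
    and F: "F \<in> borel_measurable (PiM {1..n} (\<lambda>_. X))"
      "\<And>w. w \<in> {1..n} \<rightarrow>\<^sub>E space X \<Longrightarrow> \<bar>F w\<bar> \<le> c"
  shows "(\<integral>w. F w \<partial>PiM {1..n} (\<lambda>i. if i < t then D else if i = t then Q else R))
    = (\<integral>x. (\<integral>y. (\<integral>z. F (splice_at n t x y z) \<partial>iid n R) \<partial>iid n D) \<partial>Q)"
proof -
  let ?p = "\<lambda>(x, y, z). splice_at n t x y z" and ?S = "PiM {1..n} (\<lambda>_. X)"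
  have [measurable_cong]: "sets (iid n D) = sets ?S" "sets (iid n R) = sets ?S" "sets Q = sets X"
    using prob_algebra_iid[OF D, of n] prob_algebra_iid[OF R, of n] Q by (auto simp: space_prob_algebra)
  note sets = this
  interpret Q: prob_space Q using Q by (simp add: space_prob_algebra)
  interpret iD: prob_space "iid n D" using prob_algebra_iid[OF D, of n] by (simp add: space_prob_algebra)
  interpret iR: prob_space "iid n R" using prob_algebra_iid[OF R, of n] by (simp add: space_prob_algebra)
  interpret pDR: pair_prob_space "iid n D" "iid n R" ..
  interpret pQ: pair_prob_space Q "iid n D \<Otimes>\<^sub>M iid n R" ..
  have meas: "?p \<in> Q \<Otimes>\<^sub>M iid n D \<Otimes>\<^sub>M iid n R \<rightarrow>\<^sub>M ?S"
    using splice_at_measurable[of n t X] sets by (simp cong: measurable_cong_sets sets_pair_measure_cong)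
  have bound: "\<bar>F (?p q)\<bar> \<le> c" if "q \<in> space (Q \<Otimes>\<^sub>M iid n D \<Otimes>\<^sub>M iid n R)" for q
    using measurable_space[OF meas that] by (intro F(2)) (simp add: space_PiM)
  have int: "integrable (Q \<Otimes>\<^sub>M iid n D \<Otimes>\<^sub>M iid n R) (\<lambda>q. F (?p q))"
    by (rule pQ.integrable_const_bound[where B=c])
       (use bound in auto, rule measurable_compose[OF meas F(1)])
  have "(\<integral>w. F w \<partial>PiM {1..n} (\<lambda>i. if i < t then D else if i = t then Q else R))
      = (\<integral>q. F (?p q) \<partial>(Q \<Otimes>\<^sub>M iid n D \<Otimes>\<^sub>M iid n R))"
    unfolding distr_splice_at[OF D Q R t, symmetric] by (rule integral_distr[OF meas F(1)])
  also have "\<dots> = (\<integral>x. (\<integral>r. F (?p (x, r)) \<partial>(iid n D \<Otimes>\<^sub>M iid n R)) \<partial>Q)"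
    by (rule pQ.integral_fst'[symmetric, OF int])
  also have "\<dots> = (\<integral>x. (\<integral>y. (\<integral>z. F (splice_at n t x y z) \<partial>iid n R) \<partial>iid n D) \<partial>Q)"
  proof (rule Bochner_Integration.integral_cong[OF refl])
    fix x assume x: "x \<in> space Q"
    have "(\<lambda>r. F (?p (x, r))) \<in> borel_measurable (iid n D \<Otimes>\<^sub>M iid n R)"
      by (rule measurable_compose[OF measurable_Pair1'[OF x] measurable_compose[OF meas F(1)]])
    then have "integrable (iid n D \<Otimes>\<^sub>M iid n R) (\<lambda>r. F (?p (x, r)))"
      by (rule pDR.integrable_const_bound[where B=c, rotated])
         (use bound x in \<open>auto simp: space_pair_measure\<close>)
    from pDR.integral_fst'[OF this]
    show "(\<integral>r. F (?p (x, r)) \<partial>(iid n D \<Otimes>\<^sub>M iid n R)) = (\<integral>y. (\<integral>z. F (splice_at n t x y z) \<partial>iid n R) \<partial>iid n D)"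
      by simp
  qed
  finally show ?thesis .
qed

subsection \<open>Online algorithms\<close>

lemma bind_assoc_prob_algebra:
  assumes "\<mu> \<in> space (prob_algebra A)" "K \<in> A \<rightarrow>\<^sub>M prob_algebra B" "L \<in> B \<rightarrow>\<^sub>M prob_algebra C"
  shows "\<mu> \<bind> K \<bind> L = \<mu> \<bind> (\<lambda>x. K x \<bind> L)"
proof -
  have [measurable_cong]: "sets \<mu> = sets A" using assms by (simp add: space_prob_algebra)
  note [measurable] = assms(2)
  have "K \<in> \<mu> \<rightarrow>\<^sub>M subprob_algebra B"
    by (rule measurable_prob_algebraD) measurable
  then show ?thesis
    by (rule bind_assoc) (rule measurable_prob_algebraD, fact)
qed

lemma space_iid: "D \<in> space (prob_algebra X) \<Longrightarrow> space (iid n D) = {1..n} \<rightarrow>\<^sub>E space X"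
  by (simp add: iid_def space_PiM space_prob_algebra sets_eq_imp_space_eq[of D X])

lemma measurable_section:
  assumes "(\<lambda>(x, s). f x s) \<in> A \<Otimes>\<^sub>M B \<rightarrow>\<^sub>M C" "x \<in> space A"
  shows "f x \<in> B \<rightarrow>\<^sub>M C"
  using measurable_compose[OF measurable_Pair1'[OF assms(2)] assms(1)] by simp

lemma evolve_cong:
  "(\<And>i. i \<in> {t<..t + k} \<Longrightarrow> x i = y i) \<Longrightarrow> evolve S M x t k s = evolve S M y t k s"
  by (induction k arbitrary: s) (auto intro!: bind_cong)

lemma state_after_cong:
  assumes "1 \<le> t" "\<And>i. i \<in> {1..t} \<Longrightarrow> x i = y i"
  shows "state_after S M x t = state_after S M y t"
proof -
  have "evolve S M x 1 (t - 1) s = evolve S M y 1 (t - 1) s" for s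
    by (rule evolve_cong) (use assms in auto)
  then show ?thesis
    using assms by (simp add: state_after_def cong: bind_cong)
qed

section \<open>Measurability and decomposition of runs\<close>

context
  fixes X :: "'x measure" and S :: "'s measure" and Y :: "'o measure" and n :: nat
    and M :: "('x, 's, 'o) online_alg"
  assumes alg: "online_algorithm X S Y n M"
begin

lemma init_map_measurable: "init_map M \<in> X \<rightarrow>\<^sub>M prob_algebra S"
  and step_map_measurable: "i \<in> {2..n} \<Longrightarrow> step_map M i \<in> X \<Otimes>\<^sub>M S \<rightarrow>\<^sub>M prob_algebra S"
  and output_map_measurable: "output_map M \<in> S \<rightarrow>\<^sub>M prob_algebra Y"
  using alg by (auto simp: online_algorithm_def)

text \<open>Measurability is proved jointly in stream and state because streams will themselves be
  sampled and exchanged with states by Fubini.\<close>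

lemma evolve_measurable:
  assumes "1 \<le> t" "t + k \<le> n"
  shows "(\<lambda>(x, s). evolve S M x t k s) \<in> PiM {1..n} (\<lambda>_. X) \<Otimes>\<^sub>M S \<rightarrow>\<^sub>M prob_algebra S"
  using assms(2)
proof (induction k)
  case 0
  show ?case
    using measurable_compose[OF measurable_snd measurable_return_prob_space] by (simp add: split_beta')
next
  case (Suc k)
  let ?i = "t + k + 1"
  \<comment> \<open>The assumption \<open>1 \<le> t\<close> keeps the step index at 2 or more, the
    range in which step maps are kernels; the first element is consumed by
    \<open>init_map\<close>.\<close>
  have i: "?i \<in> {1..n}" and i2: "?i \<in> {2..n}"
    using assms(1) Suc.prems by auto
  have "(\<lambda>(p, s'). (fst p ?i, s')) \<in> (PiM {1..n} (\<lambda>_. X) \<Otimes>\<^sub>M S) \<Otimes>\<^sub>M S \<rightarrow>\<^sub>M X \<Otimes>\<^sub>M S"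
    using measurable_component_singleton[OF i, of "\<lambda>_. X"] by measurable
  from measurable_compose[OF this step_map_measurable[OF i2]]
  have "(\<lambda>(p, s'). step_map M ?i (fst p ?i, s')) \<in> (PiM {1..n} (\<lambda>_. X) \<Otimes>\<^sub>M S) \<Otimes>\<^sub>M S \<rightarrow>\<^sub>M prob_algebra S"
    by (simp add: split_beta')
  from measurable_bind_prob_space2[OF Suc.IH this] Suc.prems show ?case
    by (simp add: split_beta')
qed

lemma evolve_section:
  "1 \<le> t \<Longrightarrow> t + k \<le> n \<Longrightarrow> x \<in> {1..n} \<rightarrow>\<^sub>E space X \<Longrightarrow> evolve S M x t k \<in> S \<rightarrow>\<^sub>M prob_algebra S"
  by (rule measurable_section[OF evolve_measurable]) (auto simp: space_PiM)

lemma state_after_measurable: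
  assumes "t \<in> {1..n}"
  shows "(\<lambda>x. state_after S M x t) \<in> PiM {1..n} (\<lambda>_. X) \<rightarrow>\<^sub>M prob_algebra S"
  unfolding state_after_def
proof (rule measurable_bind_prob_space2)
  have "1 \<in> {1..n}" using assms by auto
  from measurable_component_singleton[OF this]
  show "(\<lambda>x. init_map M (x 1)) \<in> PiM {1..n} (\<lambda>_. X) \<rightarrow>\<^sub>M prob_algebra S"
    by (rule measurable_compose[OF _ init_map_measurable])
  show "(\<lambda>(x, s). evolve S M x 1 (t - 1) s) \<in> PiM {1..n} (\<lambda>_. X) \<Otimes>\<^sub>M S \<rightarrow>\<^sub>M prob_algebra S"
    by (rule evolve_measurable) (use assms in auto)
qed

lemma state_after_in_prob_algebra:
  "t \<in> {1..n} \<Longrightarrow> x \<in> {1..n} \<rightarrow>\<^sub>E space X \<Longrightarrow> state_after S M x t \<in> space (prob_algebra S)"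
  using measurable_space[OF state_after_measurable, of t x] by (simp add: space_PiM)

lemma evolve_output_measurable:
  assumes "t \<in> {1..n}"
  shows "(\<lambda>(x, s). evolve S M x t (n - t) s \<bind> output_map M) \<in> PiM {1..n} (\<lambda>_. X) \<Otimes>\<^sub>M S \<rightarrow>\<^sub>M prob_algebra Y"
  using measurable_bind_prob_space[OF evolve_measurable[of t "n - t"] output_map_measurable] assms
  by (simp add: split_beta')

lemma run_output_measurable:
  "1 \<le> n \<Longrightarrow> run_output S M n \<in> PiM {1..n} (\<lambda>_. X) \<rightarrow>\<^sub>M prob_algebra Y"
  using measurable_bind_prob_space[OF state_after_measurable[of n] output_map_measurable]
  by (simp add: run_output_def[abs_def])

text \<open>This is the Chapman-Kolmogorov identity: each further step appends one kernel on the
  right, and associativity of \<open>\<bind>\<close> regroups.\<close>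

lemma evolve_add:
  assumes "1 \<le> t" "t + (k + l) \<le> n" "x \<in> {1..n} \<rightarrow>\<^sub>E space X" "s \<in> space S"
  shows "evolve S M x t (k + l) s = evolve S M x t k s \<bind> evolve S M x (t + k) l"
  using assms(2)
proof (induction l)
  case 0
  have "evolve S M x t k s \<in> space (prob_algebra S)"
    using measurable_space[OF evolve_section[OF assms(1) _ assms(3)] assms(4)] 0 by simp
  then show ?case
    by (simp add: space_prob_algebra bind_return'')
next
  case (Suc l)
  let ?i = "t + k + l + 1"
  have i: "x ?i \<in> space X" and i2: "?i \<in> {2..n}"
    using assms(1) Suc.prems by (auto intro!: PiE_mem[OF assms(3)])
  have step: "(\<lambda>s'. step_map M ?i (x ?i, s')) \<in> S \<rightarrow>\<^sub>M prob_algebra S"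
    by (rule measurable_compose[OF measurable_Pair1'[OF i] step_map_measurable[OF i2]])
  have mid: "evolve S M x t k s \<in> space (prob_algebra S)"
    using measurable_space[OF evolve_section[OF assms(1) _ assms(3)] assms(4)] Suc.prems by simp
  have ev: "evolve S M x (t + k) l \<in> S \<rightarrow>\<^sub>M prob_algebra S"
    by (rule evolve_section) (use assms(1,3) Suc.prems in auto)
  show ?case
    using Suc bind_assoc_prob_algebra[OF mid ev step] by (simp add: add.assoc)
qed

text \<open>The run is cut at time \<open>t\<close>: its first \<open>t - 1\<close> and last
  \<open>n - t\<close> transitions make up all \<open>n - 1\<close> that follow
  \<open>init_map\<close>. The state after \<open>t\<close> elements is the only link between the
  two halves.\<close>

lemma run_output_decompose:
  assumes t: "t \<in> {1..n}" and x: "x \<in> {1..n} \<rightarrow>\<^sub>E space X"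
  shows "run_output S M n x = state_after S M x t \<bind> (\<lambda>s. evolve S M x t (n - t) s \<bind> output_map M)"
proof -
  have x1: "init_map M (x 1) \<in> space (prob_algebra S)"
    using t by (intro measurable_space[OF init_map_measurable] PiE_mem[OF x]) auto
  then have sp: "space (init_map M (x 1)) = space S"
    by (auto simp: space_prob_algebra dest: sets_eq_imp_space_eq)
  have ev1: "evolve S M x 1 (t - 1) \<in> S \<rightarrow>\<^sub>M prob_algebra S"
    and ev2: "evolve S M x t (n - t) \<in> S \<rightarrow>\<^sub>M prob_algebra S"
    by (rule evolve_section; use t x in auto)+
  have "evolve S M x 1 (n - 1) s = evolve S M x 1 (t - 1) s \<bind> evolve S M x t (n - t)"
    if "s \<in> space S" for s
    using evolve_add[of 1 "t - 1" "n - t" x s] t x that by simp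
  then have "state_after S M x n = init_map M (x 1) \<bind> (\<lambda>s. evolve S M x 1 (t - 1) s \<bind> evolve S M x t (n - t))"
    unfolding state_after_def using sp by (intro bind_cong) auto
  also have "\<dots> = state_after S M x t \<bind> evolve S M x t (n - t)"
    unfolding state_after_def by (rule bind_assoc_prob_algebra[OF x1 ev1 ev2, symmetric])
  finally show ?thesis
    unfolding run_output_def
    using bind_assoc_prob_algebra[OF state_after_in_prob_algebra[OF t x] ev2 output_map_measurable] by simp
qed

section \<open>Privacy of the state as a function of one sample\<close>

text \<open>The continuation from an observed state has total mass 1, so an event that leaves the
  output free has the mass of its state part. This extracts privacy of the state alone from the
  joint condition.\<close>

lemma measure_state_output:
  assumes t: "t \<in> {1..n}" and x: "x \<in> {1..n} \<rightarrow>\<^sub>E space X" and A: "A \<in> sets S"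
  shows "measure (state_output S Y M n x t) (A \<times> space Y) = measure (state_after S M x t) A"
proof -
  let ?T = "A \<times> space Y"
  let ?ret = "\<lambda>s y. return (S \<Otimes>\<^sub>M Y) (s, y)"
  let ?out = "\<lambda>s s'. output_map M s' \<bind> ?ret s"
  let ?ev = "evolve S M x t (n - t)"
  have T: "?T \<in> sets (S \<Otimes>\<^sub>M Y)" using A by simp
  have ret: "(\<lambda>(s, y). ?ret s y) \<in> S \<Otimes>\<^sub>M Y \<rightarrow>\<^sub>M prob_algebra (S \<Otimes>\<^sub>M Y)"
    using measurable_return_prob_space[of "S \<Otimes>\<^sub>M Y"] by (simp add: split_beta')
  have "(\<lambda>q. output_map M (snd q)) \<in> S \<Otimes>\<^sub>M S \<rightarrow>\<^sub>M prob_algebra Y"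
    by (rule measurable_compose[OF measurable_snd output_map_measurable])
  moreover have "(\<lambda>(q, y). ?ret (fst q) y) \<in> (S \<Otimes>\<^sub>M S) \<Otimes>\<^sub>M Y \<rightarrow>\<^sub>M prob_algebra (S \<Otimes>\<^sub>M Y)"
    by (simp add: split_beta')
  ultimately have "(\<lambda>q. ?out (fst q) (snd q)) \<in> S \<Otimes>\<^sub>M S \<rightarrow>\<^sub>M prob_algebra (S \<Otimes>\<^sub>M Y)"
    by (rule measurable_bind_prob_space2)
  then have out: "(\<lambda>(s, s'). ?out s s') \<in> S \<Otimes>\<^sub>M S \<rightarrow>\<^sub>M prob_algebra (S \<Otimes>\<^sub>M Y)"
    by (simp add: split_beta')
  have ev: "?ev \<in> S \<rightarrow>\<^sub>M prob_algebra S"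
    by (rule evolve_section) (use t x in auto)
  have inner: "(\<lambda>s. ?ev s \<bind> ?out s) \<in> S \<rightarrow>\<^sub>M prob_algebra (S \<Otimes>\<^sub>M Y)"
    by (rule measurable_bind_prob_space2[OF ev out])
  have st: "state_after S M x t \<in> space (prob_algebra S)"
    by (rule state_after_in_prob_algebra[OF t x])
  have out_val: "measure (?out s s') ?T = indicator A s" if s: "s \<in> space S" "s' \<in> space S" for s s'
  proof -
    have o: "output_map M s' \<in> space (prob_algebra Y)"
      by (rule measurable_space[OF output_map_measurable s(2)])
    have "measure (?out s s') ?T = (\<integral>y. measure (?ret s y) ?T \<partial>output_map M s')"
      by (rule measure_bind_prob_algebra[OF o measurable_section[OF ret s(1)] T])
    also have "\<dots> = (\<integral>y. indicator A s \<partial>output_map M s')"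
    proof (rule Bochner_Integration.integral_cong[OF refl])
      fix y assume "y \<in> space (output_map M s')"
      then have "y \<in> space Y"
        using o by (auto simp: space_prob_algebra dest: sets_eq_imp_space_eq)
      then show "measure (?ret s y) ?T = indicator A s"
        using measure_return[OF T, of "(s, y)"] by (simp add: indicator_def)
    qed
    also have "\<dots> = indicator A s"
      using o by (simp add: space_prob_algebra prob_space.prob_space)
    finally show ?thesis .
  qed
  have in_val: "measure (?ev s \<bind> ?out s) ?T = indicator A s" if s: "s \<in> space S" for s
  proof -
    have e: "?ev s \<in> space (prob_algebra S)"
      by (rule measurable_space[OF ev s])
    have "measure (?ev s \<bind> ?out s) ?T = (\<integral>s'. measure (?out s s') ?T \<partial>?ev s)"
      by (rule measure_bind_prob_algebra[OF e measurable_section[OF out s] T])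
    also have "\<dots> = (\<integral>s'. indicator A s \<partial>?ev s)"
      using e by (intro Bochner_Integration.integral_cong refl out_val s)
        (auto simp: space_prob_algebra dest: sets_eq_imp_space_eq)
    also have "\<dots> = indicator A s"
      using e by (simp add: space_prob_algebra prob_space.prob_space)
    finally show ?thesis .
  qed
  have sets: "sets (state_after S M x t) = sets S"
    using st by (simp add: space_prob_algebra)
  have "measure (state_output S Y M n x t) ?T = (\<integral>s. measure (?ev s \<bind> ?out s) ?T \<partial>state_after S M x t)"
    unfolding state_output_def by (rule measure_bind_prob_algebra[OF st inner T])
  also have "\<dots> = (\<integral>s. indicator A s \<partial>state_after S M x t)"
    using sets by (intro Bochner_Integration.integral_cong refl in_val) (auto dest: sets_eq_imp_space_eq)
  also have "\<dots> = measure (state_after S M x t) A"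
    using A sets sets.sets_into_space[OF A] sets_eq_imp_space_eq[OF sets] by (simp add: Int_absorb2)
  finally show ?thesis .
qed

text \<open>The entry \<open>y t\<close> is overwritten and later entries do not affect the state after \<open>t\<close>
  elements, so sampling a whole stream \<open>y\<close> merely avoids a special case for \<open>t = 1\<close>.\<close>

definition local_kernel :: "'x measure \<Rightarrow> nat \<Rightarrow> 'x \<Rightarrow> 's measure" where
  "local_kernel D t x = iid n D \<bind> (\<lambda>y. state_after S M (y(t := x)) t)"

lemma fun_upd_stream:
  "t \<in> {1..n} \<Longrightarrow> y \<in> {1..n} \<rightarrow>\<^sub>E space X \<Longrightarrow> x \<in> space X \<Longrightarrow> y(t := x) \<in> {1..n} \<rightarrow>\<^sub>E space X"
  by (auto simp: PiE_iff extensional_def)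

lemma state_after_upd_measurable:
  assumes t: "t \<in> {1..n}"
  shows "(\<lambda>(x, y). state_after S M (y(t := x)) t) \<in> X \<Otimes>\<^sub>M PiM {1..n} (\<lambda>_. X) \<rightarrow>\<^sub>M prob_algebra S"
proof -
  have "(\<lambda>(y, x). y(t := x)) \<in> PiM {1..n} (\<lambda>_. X) \<Otimes>\<^sub>M X \<rightarrow>\<^sub>M PiM {1..n} (\<lambda>_. X)"
    using measurable_add_dim[of t "{1..n}" "\<lambda>_. X"] t by (simp only: insert_absorb)
  from measurable_compose[OF measurable_pair_swap' measurable_compose[OF this state_after_measurable[OF t]]]
  show ?thesis by (simp add: split_beta')
qed

lemma local_kernel_measurable:
  assumes t: "t \<in> {1..n}" and D: "D \<in> space (prob_algebra X)"
  shows "local_kernel D t \<in> X \<rightarrow>\<^sub>M prob_algebra S"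
  unfolding local_kernel_def[abs_def]
  by (rule measurable_bind_prob_space2[OF measurable_const[OF prob_algebra_iid[OF D]] state_after_upd_measurable[OF t]])

text \<open>For each fixed \<open>y\<close>, the streams \<open>y(t := x)\<close> and
  \<open>y(t := x')\<close> differ at most at \<open>t\<close>, so pan-privacy applies to their
  states after \<open>t\<close> elements. The inequality is affine in the two probabilities and
  survives averaging over \<open>y\<close>.\<close>

lemma local_kernel_private:
  assumes pp: "pan_private X S Y n \<epsilon> \<delta> M" and t: "t \<in> {1..n}" and D: "D \<in> space (prob_algebra X)"
    and x: "x \<in> space X" "x' \<in> space X" and A: "A \<in> sets S"
  shows "measure (local_kernel D t x) A \<le> exp \<epsilon> * measure (local_kernel D t x') A + \<delta>"
proof -
  let ?q = "\<lambda>x y. measure (state_after S M (y(t := x)) t) A"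
  note iid = prob_algebra_iid[OF D, of n]
  interpret prob_space "iid n D" using iid by (simp add: space_prob_algebra)
  have sp: "space (iid n D) = {1..n} \<rightarrow>\<^sub>E space X"
    by (rule space_iid[OF D])
  have sec: "(\<lambda>y. state_after S M (y(t := x)) t) \<in> PiM {1..n} (\<lambda>_. X) \<rightarrow>\<^sub>M prob_algebra S"
    if "x \<in> space X" for x
    by (rule measurable_section[OF state_after_upd_measurable[OF t] that])
  have lk: "measure (local_kernel D t x) A = (\<integral>y. ?q x y \<partial>iid n D)" if "x \<in> space X" for x
    unfolding local_kernel_def by (rule measure_bind_prob_algebra[OF iid sec[OF that] A])
  have int: "integrable (iid n D) (?q x)" if x: "x \<in> space X" for x
  proof (rule integrable_prob_algebra[OF iid, of _ 1])
    show "?q x \<in> borel_measurable (PiM {1..n} (\<lambda>_. X))"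
      by (rule measurable_compose[OF sec[OF x] measurable_measure_prob_algebra[OF A]])
    show "\<bar>?q x y\<bar> \<le> 1" if "y \<in> space (PiM {1..n} (\<lambda>_. X))" for y
      using measurable_space[OF sec[OF x] that] by (auto simp: space_prob_algebra intro: prob_space.prob_le_1)
  qed
  have "?q x y \<le> exp \<epsilon> * ?q x' y + \<delta>" if y: "y \<in> space (iid n D)" for y
  proof -
    have y': "y(t := x) \<in> {1..n} \<rightarrow>\<^sub>E space X" "y(t := x') \<in> {1..n} \<rightarrow>\<^sub>E space X"
      using fun_upd_stream[OF t] y x sp by auto
    have "card {i\<in>{1..n}. (y(t := x)) i \<noteq> (y(t := x')) i} \<le> card {t}"
      by (intro card_mono) auto
    then have "neighbors n (y(t := x)) (y(t := x'))"
      by (simp add: neighbors_def)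
    moreover have "A \<times> space Y \<in> sets (S \<Otimes>\<^sub>M Y)" using A by simp
    ultimately show ?thesis
      using pp y' t unfolding pan_private_def
      by (metis measure_state_output[OF t y'(1) A] measure_state_output[OF t y'(2) A])
  qed
  then have "(\<integral>y. ?q x y \<partial>iid n D) \<le> (\<integral>y. exp \<epsilon> * ?q x' y + \<delta> \<partial>iid n D)"
    using int x by (intro integral_mono) auto
  then show ?thesis
    using int x by (simp add: lk prob_space)
qed

section \<open>Reduction of the output to the state after \<open>t\<close> elements\<close>

text \<open>The probability of output in \<open>B\<close> from state \<open>s\<close> with later
  samples drawn from \<open>R\<close> serves as a test function on states. It varies with
  \<open>v\<close> once \<open>R = P v\<close>, whereas the kernel producing the state does
  not.\<close>

definition future_value :: "'x measure \<Rightarrow> nat \<Rightarrow> 'o set \<Rightarrow> 's \<Rightarrow> real" where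
  "future_value R t B s = (\<integral>z. measure (evolve S M z t (n - t) s \<bind> output_map M) B \<partial>iid n R)"

text \<open>After splicing, the past and the sample at \<open>t\<close> enter only through the state
  after \<open>t\<close> elements, and the future only through the continuation. Averaging the
  future first leaves a \<open>[0, 1]\<close>-valued function of the state, integrated over the law
  that \<open>local_kernel\<close> produces.\<close>

lemma hybrid_output:
  assumes D: "D \<in> space (prob_algebra X)" and Q: "Q \<in> space (prob_algebra X)"
    and R: "R \<in> space (prob_algebra X)" and t: "t \<in> {1..n}" and B: "B \<in> sets Y"
  shows "measure (PiM {1..n} (\<lambda>i. if i < t then D else if i = t then Q else R) \<bind> run_output S M n) B
    = (\<integral>s. future_value R t B s \<partial>(Q \<bind> local_kernel D t))"
    and "future_value R t B \<in> borel_measurable S"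
    and "\<And>s. s \<in> space S \<Longrightarrow> 0 \<le> future_value R t B s \<and> future_value R t B s \<le> 1"
proof -
  let ?S = "PiM {1..n} (\<lambda>_. X)"
  let ?g = "future_value R t B"
  let ?G = "\<lambda>z s. measure (evolve S M z t (n - t) s \<bind> output_map M) B"
  let ?F = "\<lambda>w. measure (run_output S M n w) B"
  have n: "1 \<le> n" using t by auto
  note iidD = prob_algebra_iid[OF D, of n] and iidR = prob_algebra_iid[OF R, of n]
  interpret iR: prob_space "iid n R" using iidR by (simp add: space_prob_algebra)
  have spR: "space (iid n R) = {1..n} \<rightarrow>\<^sub>E space X" "space (iid n D) = {1..n} \<rightarrow>\<^sub>E space X" "space Q = space X"
    using Q by (simp_all add: space_iid[OF R] space_iid[OF D] space_prob_algebra sets_eq_imp_space_eq[of Q X])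
  have setsR: "sets (iid n R) = sets ?S"
    using iidR by (simp add: space_prob_algebra)
  have Gm: "(\<lambda>(z, s). ?G z s) \<in> borel_measurable (?S \<Otimes>\<^sub>M S)"
    using measurable_compose[OF evolve_output_measurable[OF t] measurable_measure_prob_algebra[OF B]]
    by (simp add: split_beta')
  have G1: "0 \<le> ?G z s \<and> ?G z s \<le> 1" if "z \<in> {1..n} \<rightarrow>\<^sub>E space X" "s \<in> space S" for z s
    using measurable_space[OF evolve_output_measurable[OF t], of "(z, s)"] that
    by (auto simp: space_pair_measure space_PiM space_prob_algebra intro: prob_space.prob_le_1)
  have "(\<lambda>(s, z). ?G z s) \<in> borel_measurable (S \<Otimes>\<^sub>M ?S)"
    using measurable_compose[OF measurable_pair_swap' Gm] by (simp add: split_beta')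
  then have "(\<lambda>(s, z). ?G z s) \<in> borel_measurable (S \<Otimes>\<^sub>M iid n R)"
    using setsR by (simp cong: measurable_cong_sets sets_pair_measure_cong)
  then show gm: "?g \<in> borel_measurable S"
    unfolding future_value_def[abs_def] by (rule iR.borel_measurable_lebesgue_integral)
  show g1: "0 \<le> ?g s \<and> ?g s \<le> 1" if s: "s \<in> space S" for s
  proof
    show "0 \<le> ?g s" unfolding future_value_def by (rule Bochner_Integration.integral_nonneg) simp
    have "(\<lambda>z. ?G z s) \<in> borel_measurable ?S"
      using measurable_compose[OF measurable_Pair2'[OF s] Gm] by simp
    then show "?g s \<le> 1"
      unfolding future_value_def by (rule integral_le_const_prob_algebra[OF iidR]) (use G1 s in \<open>auto simp: space_PiM\<close>)
  qed
  have upd: "state_after S M (y(t := x)) t \<in> space (prob_algebra S)"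
    if "x \<in> space X" "y \<in> {1..n} \<rightarrow>\<^sub>E space X" for x y
    by (rule state_after_in_prob_algebra[OF t fun_upd_stream[OF t that(2,1)]])
  have Fm: "?F \<in> borel_measurable ?S"
    by (rule measurable_compose[OF run_output_measurable[OF n] measurable_measure_prob_algebra[OF B]])
  have F1: "\<bar>?F w\<bar> \<le> 1" if "w \<in> {1..n} \<rightarrow>\<^sub>E space X" for w
    using measurable_space[OF run_output_measurable[OF n], of w] that
    by (auto simp: space_PiM space_prob_algebra intro: prob_space.prob_le_1)
  have Fs: "?F (splice_at n t x y z) = (\<integral>s. ?G z s \<partial>state_after S M (y(t := x)) t)"
    if x: "x \<in> space X" and y: "y \<in> {1..n} \<rightarrow>\<^sub>E space X" and z: "z \<in> {1..n} \<rightarrow>\<^sub>E space X" for x y z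
  proof -
    let ?w = "splice_at n t x y z"
    have w: "?w \<in> {1..n} \<rightarrow>\<^sub>E space X"
      using x y z by (auto simp: splice_at_def PiE_iff)
    have st: "state_after S M ?w t = state_after S M (y(t := x)) t"
      by (rule state_after_cong) (use t in \<open>auto simp: splice_at_def\<close>)
    have ev: "evolve S M ?w t (n - t) = evolve S M z t (n - t)"
      by (rule ext, rule evolve_cong) (use t in \<open>auto simp: splice_at_def\<close>)
    have "run_output S M n ?w = state_after S M (y(t := x)) t \<bind> (\<lambda>s. evolve S M z t (n - t) s \<bind> output_map M)"
      unfolding run_output_decompose[OF t w] st ev ..
    moreover have "z \<in> space ?S" using z by (simp add: space_PiM)
    ultimately show ?thesis
      using measure_bind_prob_algebra[OF upd[OF x y] measurable_section[OF evolve_output_measurable[OF t]] B]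
      by simp
  qed
  \<comment> \<open>The law of the state involves \<open>x\<close> and \<open>y\<close> but not
    \<open>z\<close>, so Fubini moves the average over futures inside.\<close>
  have swap: "(\<integral>z. (\<integral>s. ?G z s \<partial>state_after S M (y(t := x)) t) \<partial>iid n R) = (\<integral>s. ?g s \<partial>state_after S M (y(t := x)) t)"
    if x: "x \<in> space X" and y: "y \<in> {1..n} \<rightarrow>\<^sub>E space X" for x y
  proof -
    let ?\<mu> = "state_after S M (y(t := x)) t"
    interpret \<mu>: prob_space ?\<mu> using upd[OF x y] by (simp add: space_prob_algebra)
    interpret p: pair_prob_space "iid n R" ?\<mu> ..
    have s\<mu>: "sets ?\<mu> = sets S" using upd[OF x y] by (simp add: space_prob_algebra)
    have "integrable (iid n R \<Otimes>\<^sub>M ?\<mu>) (\<lambda>(z, s). ?G z s)"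
    proof (rule p.integrable_const_bound[where B=1])
      show "(\<lambda>(z, s). ?G z s) \<in> borel_measurable (iid n R \<Otimes>\<^sub>M ?\<mu>)"
        using Gm setsR s\<mu> by (simp cong: measurable_cong_sets sets_pair_measure_cong)
      show "AE q in iid n R \<Otimes>\<^sub>M ?\<mu>. norm (case q of (z, s) \<Rightarrow> ?G z s) \<le> 1"
        using G1 spR sets_eq_imp_space_eq[OF s\<mu>] by (intro AE_I2) (auto simp: space_pair_measure)
    qed
    from p.Fubini_integral[OF this] show ?thesis by (simp add: future_value_def)
  qed
  have "PiM {1..n} (\<lambda>i. if i < t then D else if i = t then Q else R) \<in> space (prob_algebra ?S)"
    using D Q R by (intro prob_algebra_PiM) simp
  from measure_bind_prob_algebra[OF this run_output_measurable[OF n] B]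
  have "measure (PiM {1..n} (\<lambda>i. if i < t then D else if i = t then Q else R) \<bind> run_output S M n) B
      = (\<integral>x. (\<integral>y. (\<integral>z. ?F (splice_at n t x y z) \<partial>iid n R) \<partial>iid n D) \<partial>Q)"
    using integral_splice_at[OF D Q R t Fm F1] by simp
  also have "\<dots> = (\<integral>x. (\<integral>y. (\<integral>s. ?g s \<partial>state_after S M (y(t := x)) t) \<partial>iid n D) \<partial>Q)"
  proof (intro Bochner_Integration.integral_cong[OF refl])
    fix x y assume "x \<in> space Q" "y \<in> space (iid n D)"
    then have xy: "x \<in> space X" "y \<in> {1..n} \<rightarrow>\<^sub>E space X" by (simp_all only: spR)
    have "(\<integral>z. ?F (splice_at n t x y z) \<partial>iid n R) = (\<integral>z. (\<integral>s. ?G z s \<partial>state_after S M (y(t := x)) t) \<partial>iid n R)"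
      by (intro Bochner_Integration.integral_cong[OF refl] Fs xy) (simp only: spR)
    then show "(\<integral>z. ?F (splice_at n t x y z) \<partial>iid n R) = (\<integral>s. ?g s \<partial>state_after S M (y(t := x)) t)"
      unfolding swap[OF xy] .
  qed
  also have "\<dots> = (\<integral>x. (\<integral>s. ?g s \<partial>local_kernel D t x) \<partial>Q)"
  proof (rule Bochner_Integration.integral_cong[OF refl])
    fix x assume "x \<in> space Q"
    then have "x \<in> space X" by (simp only: spR)
    note sec = measurable_section[OF state_after_upd_measurable[OF t] this]
    show "(\<integral>y. (\<integral>s. ?g s \<partial>state_after S M (y(t := x)) t) \<partial>iid n D) = (\<integral>s. ?g s \<partial>local_kernel D t x)"
      unfolding local_kernel_def
      by (rule integral_bind_prob_algebra[OF iidD sec gm, symmetric, of 1]) (use g1 in fastforce)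
  qed
  also have "\<dots> = (\<integral>s. ?g s \<partial>(Q \<bind> local_kernel D t))"
    by (rule integral_bind_prob_algebra[OF Q local_kernel_measurable[OF t D] gm, symmetric, of 1]) (use g1 in fastforce)
  finally show "measure (PiM {1..n} (\<lambda>i. if i < t then D else if i = t then Q else R) \<bind> run_output S M n) B
    = (\<integral>s. ?g s \<partial>(Q \<bind> local_kernel D t))" .
qed

end

subsection \<open>The hybrid argument\<close>

definition hybrid :: "nat \<Rightarrow> 'x measure \<Rightarrow> 'x measure \<Rightarrow> nat \<Rightarrow> (nat \<Rightarrow> 'x) measure" where
  "hybrid n D R t = PiM {1..n} (\<lambda>i. if i \<le> t then D else R)"

lemma hybrid_0: "hybrid n D R 0 = iid n R"
  unfolding hybrid_def iid_def by (rule PiM_cong) auto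

lemma hybrid_n: "hybrid n D R n = iid n D"
  unfolding hybrid_def iid_def by (rule PiM_cong) auto

text \<open>The future value depends on \<open>v\<close>, so it is not one fixed test function for
  the whole family. The Hahn sets \<open>A v\<close> absorb this dependence, leaving events tested
  on a single private kernel common to all \<open>v\<close>.\<close>

lemma hybrid_step:
  assumes "finite V" "V \<noteq> {}" and P: "\<And>v. v \<in> V \<Longrightarrow> P v \<in> space (prob_algebra X)"
    and alg: "online_algorithm X S Y n M" and pp: "pan_private X S Y n \<epsilon> \<delta> M" and \<epsilon>: "0 \<le> \<epsilon>"
    and t: "Suc t \<in> {1..n}" and B: "B \<in> sets Y"
  defines "U \<equiv> uniform_mixture V P"
  shows "(\<Sum>v\<in>V. measure (hybrid n U (P v) t \<bind> run_output S M n) B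
      - measure (hybrid n U (P v) (Suc t) \<bind> run_output S M n) B) / card V
    \<le> (exp \<epsilon> - 1) * inf_to_2_norm X V P + 4 * \<delta>"
proof -
  have U: "U \<in> space (prob_algebra X)"
    unfolding U_def by (rule uniform_mixture_in_prob_algebra[OF assms(1-3)])
  let ?K = "local_kernel S n M U (Suc t)"
  let ?g = "\<lambda>v. future_value S n M (P v) (Suc t) B"
  have K: "?K \<in> X \<rightarrow>\<^sub>M prob_algebra S"
    by (rule local_kernel_measurable[OF alg t U])
  have UK: "U \<bind> ?K \<in> space (prob_algebra S)"
    by (rule bind_in_prob_algebra[OF U K])
  have "\<exists>A\<in>sets S. \<forall>g\<in>borel_measurable S. (\<forall>x\<in>space S. 0 \<le> g x \<and> g x \<le> (1::real)) \<longrightarrow>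
    (\<integral>x. g x \<partial>(P v \<bind> ?K)) - (\<integral>x. g x \<partial>(U \<bind> ?K)) \<le> measure (P v \<bind> ?K) A - measure (U \<bind> ?K) A"
    if "v \<in> V" for v
  proof -
    have PK: "P v \<bind> ?K \<in> space (prob_algebra S)"
      by (rule bind_in_prob_algebra[OF P[OF that] K])
    then have sets: "sets (P v \<bind> ?K) = sets S" by (simp add: space_prob_algebra)
    then show ?thesis
      using Hahn_set_optimal[of "P v \<bind> ?K" "U \<bind> ?K"] PK UK
      by (simp add: space_prob_algebra sets_eq_imp_space_eq[OF sets] cong: measurable_cong_sets)
  qed
  then obtain A where A: "\<And>v. v \<in> V \<Longrightarrow> A v \<in> sets S"
    and opt: "\<And>v g. v \<in> V \<Longrightarrow> g \<in> borel_measurable S \<Longrightarrow> (\<forall>x\<in>space S. 0 \<le> g x \<and> g x \<le> (1::real)) \<Longrightarrow>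
      (\<integral>x. g x \<partial>(P v \<bind> ?K)) - (\<integral>x. g x \<partial>(U \<bind> ?K)) \<le> measure (P v \<bind> ?K) (A v) - measure (U \<bind> ?K) (A v)"
    by metis
  have "measure (hybrid n U (P v) t \<bind> run_output S M n) B
      - measure (hybrid n U (P v) (Suc t) \<bind> run_output S M n) B
    \<le> measure (P v \<bind> ?K) (A v) - measure (U \<bind> ?K) (A v)" if v: "v \<in> V" for v
  proof -
    \<comment> \<open>Both hybrids have past \<open>U\<close> and future \<open>P v\<close>; the
      sample at \<open>Suc t\<close> is drawn from \<open>P v\<close> in hybrid \<open>t\<close> and
      from \<open>U\<close> in hybrid \<open>Suc t\<close>.\<close>
    have "(\<lambda>i. if i < Suc t then U else if i = Suc t then P v else P v) = (\<lambda>i. if i \<le> t then U else P v)"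
      "(\<lambda>i. if i < Suc t then U else if i = Suc t then U else P v) = (\<lambda>i. if i \<le> Suc t then U else P v)"
      by auto
    then have "measure (hybrid n U (P v) t \<bind> run_output S M n) B = (\<integral>s. ?g v s \<partial>(P v \<bind> ?K))"
      and "measure (hybrid n U (P v) (Suc t) \<bind> run_output S M n) B = (\<integral>s. ?g v s \<partial>(U \<bind> ?K))"
      using hybrid_output(1)[OF alg U P[OF v] P[OF v] t B] hybrid_output(1)[OF alg U U P[OF v] t B]
      by (simp_all only: hybrid_def)
    then show ?thesis
      using opt[OF v hybrid_output(2)[OF alg U U P[OF v] t B]] hybrid_output(3)[OF alg U U P[OF v] t B]
      by simp
  qed
  then have "(\<Sum>v\<in>V. measure (hybrid n U (P v) t \<bind> run_output S M n) B
      - measure (hybrid n U (P v) (Suc t) \<bind> run_output S M n) B) / card V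
    \<le> (\<Sum>v\<in>V. measure (P v \<bind> ?K) (A v) - measure (U \<bind> ?K) (A v)) / card V"
    by (intro divide_right_mono sum_mono) auto
  also have "\<dots> \<le> (exp \<epsilon> - 1) * inf_to_2_norm X V P + 4 * \<delta>"
    unfolding U_def
    by (rule locally_private_kernel_bound[OF assms(1-3) K[unfolded U_def] A \<epsilon>])
       (auto intro: local_kernel_private[OF alg pp t U, unfolded U_def])
  finally show ?thesis .
qed

text \<open>This makes the lemmas on uniform mixtures available on the space of streams.\<close>

lemma mixture_of_iid_eq_uniform_mixture: "mixture_of_iid n V P = uniform_mixture V (\<lambda>v. iid n (P v))"
  by (simp add: mixture_of_iid_def uniform_mixture_def)

lemma tv_dist_output_le:
  assumes V: "finite V" "V \<noteq> {}" and P: "\<And>v. v \<in> V \<Longrightarrow> P v \<in> space (prob_algebra X)"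
    and alg: "online_algorithm X S Y n M" and pp: "pan_private X S Y n \<epsilon> \<delta> M" and \<epsilon>: "0 \<le> \<epsilon>" and n: "1 \<le> n"
  shows "tv_dist (output_dist S M n (mixture_of_iid n V P)) (output_dist S M n (iid n (uniform_mixture V P)))
    \<le> real n * ((exp \<epsilon> - 1) * inf_to_2_norm X V P + 4 * \<delta>)" (is "tv_dist ?L ?R \<le> real n * ?\<kappa>")
proof -
  let ?S = "PiM {1..n} (\<lambda>_. X)"
  define U where "U = uniform_mixture V P"
  have U: "U \<in> space (prob_algebra X)"
    unfolding U_def by (rule uniform_mixture_in_prob_algebra[OF V P])
  have iidP: "iid n (P v) \<in> space (prob_algebra ?S)" if "v \<in> V" for v
    by (rule prob_algebra_iid[OF P[OF that]])
  have mix: "mixture_of_iid n V P \<in> space (prob_algebra ?S)"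
    unfolding mixture_of_iid_eq_uniform_mixture by (rule uniform_mixture_in_prob_algebra[OF V iidP])
  note run = run_output_measurable[OF alg n]
  have L: "?L \<in> space (prob_algebra Y)" and R: "?R \<in> space (prob_algebra Y)"
    unfolding output_dist_def
    by (rule bind_in_prob_algebra[OF mix run] bind_in_prob_algebra[OF prob_algebra_iid[OF U, unfolded U_def] run])+
  interpret L: prob_space ?L using L by (simp add: space_prob_algebra)
  interpret R: prob_space ?R using R by (simp add: space_prob_algebra)
  have sets: "sets ?L = sets Y" "sets ?R = sets Y"
    using L R by (auto simp: space_prob_algebra)
  have card: "card V > 0" using V by (simp add: card_gt_0_iff)
  have one_sided: "measure ?L B - measure ?R B \<le> n * ?\<kappa>" if B: "B \<in> sets Y" for B
  proof -
    \<comment> \<open>Output laws are affine in the input law, so \<open>h 0\<close> belongs to the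
      mixture of iid streams. In \<open>h n\<close> every summand is the law for iid samples from
      \<open>U\<close>, whatever \<open>v\<close> is.\<close>
    define h where "h t = (\<Sum>v\<in>V. measure (hybrid n U (P v) t \<bind> run_output S M n) B) / card V" for t
    have "measure ?L B = (\<integral>w. measure (run_output S M n w) B \<partial>mixture_of_iid n V P)"
      unfolding output_dist_def by (rule measure_bind_prob_algebra[OF mix run B])
    also have "\<dots> = (\<Sum>v\<in>V. \<integral>w. measure (run_output S M n w) B \<partial>iid n (P v)) / card V"
      unfolding mixture_of_iid_eq_uniform_mixture
    proof (rule integral_uniform_mixture[OF V iidP])
      show "(\<lambda>w. measure (run_output S M n w) B) \<in> borel_measurable ?S"
        by (rule measurable_compose[OF run measurable_measure_prob_algebra[OF B]])
      show "\<bar>measure (run_output S M n w) B\<bar> \<le> 1" if "w \<in> space ?S" for w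
        using measurable_space[OF run that] by (auto simp: space_prob_algebra intro: prob_space.prob_le_1)
    qed
    also have "\<dots> = h 0"
      using measure_bind_prob_algebra[OF iidP run B] by (simp add: h_def hybrid_0)
    finally have "measure ?L B = h 0" .
    moreover have "measure ?R B = h n"
      using card by (simp add: h_def hybrid_n output_dist_def U_def)
    moreover have "h 0 - h n = (\<Sum>t<n. h t - h (Suc t))"
      by (rule sum_lessThan_telescope'[symmetric])
    moreover have "(\<Sum>t<n. h t - h (Suc t)) \<le> (\<Sum>t<n. ?\<kappa>)"
    proof (rule sum_mono)
      fix t assume "t \<in> {..<n}"
      then have "Suc t \<in> {1..n}" by auto
      from hybrid_step[OF V P alg pp \<epsilon> this B]
      show "h t - h (Suc t) \<le> ?\<kappa>"
        by (simp add: h_def U_def sum_subtractf diff_divide_distrib)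
    qed
    ultimately show ?thesis by simp
  qed
  \<comment> \<open>Passing to the complement of \<open>B\<close> reverses the sign of the
    difference, so the one-sided bound gives the absolute value.\<close>
  have "\<bar>measure ?L B - measure ?R B\<bar> \<le> n * ?\<kappa>" if B: "B \<in> sets Y" for B
  proof -
    have "space Y - B \<in> sets Y" using B by simp
    moreover have "space ?L = space Y" "space ?R = space Y"
      using sets sets_eq_imp_space_eq by blast+
    ultimately show ?thesis
      using one_sided[OF B] one_sided[of "space Y - B"] L.prob_compl[of B] R.prob_compl[of B] B sets
      by (simp add: abs_le_iff)
  qed
  then show ?thesis
    unfolding tv_dist_def using sets by (intro cSUP_least) (auto intro: sets.empty_sets)
qed

section \<open>One-member families and elementary estimates\<close>

lemma uniform_mixture_singleton:
  assumes "P v \<in> space (prob_algebra X)"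
  shows "uniform_mixture {v} P = P v"
proof -
  have U: "uniform_mixture {v} P \<in> space (prob_algebra X)"
    using assms by (intro uniform_mixture_in_prob_algebra) auto
  interpret P: prob_space "P v" using assms by (simp add: space_prob_algebra)
  interpret U: prob_space "uniform_mixture {v} P" using U by (simp add: space_prob_algebra)
  show ?thesis
  proof (rule measure_eqI)
    show "sets (uniform_mixture {v} P) = sets (P v)"
      using U assms by (simp add: space_prob_algebra)
    show "emeasure (uniform_mixture {v} P) A = emeasure (P v) A" if "A \<in> sets (uniform_mixture {v} P)" for A
      using measure_uniform_mixture[of "{v}" P X A] assms U that
      by (simp add: space_prob_algebra P.emeasure_eq_measure U.emeasure_eq_measure)
  qed
qed

lemma tv_dist_self: "tv_dist \<mu> \<mu> = 0"
proof -
  have "sets \<mu> \<noteq> {}" by auto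
  then show ?thesis by (simp add: tv_dist_def)
qed

lemma inf_to_2_norm_nonneg:
  assumes "finite V" "V \<noteq> {}" "\<And>v. v \<in> V \<Longrightarrow> P v \<in> space (prob_algebra X)"
  shows "0 \<le> inf_to_2_norm X V P"
  using inf_to_2_norm_bound[OF assms, where f = "\<lambda>_. 0"] by simp

text \<open>Multiplying \<open>1 - \<epsilon> \<le> exp (- \<epsilon>)\<close> by
  \<open>exp \<epsilon>\<close> gives a linear bound whose slope is controlled by the cap on
  \<open>\<epsilon>\<close>.\<close>

lemma exp_minus_one_le: "0 \<le> \<epsilon> \<Longrightarrow> \<epsilon> \<le> \<epsilon>\<^sub>0 \<Longrightarrow> exp \<epsilon> - 1 \<le> exp \<epsilon>\<^sub>0 * (\<epsilon>::real)"
proof -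
  assume "0 \<le> \<epsilon>" "\<epsilon> \<le> \<epsilon>\<^sub>0"
  have "1 - \<epsilon> \<le> exp (- \<epsilon>)"
    using exp_ge_add_one_self[of "- \<epsilon>"] by simp
  then have "exp \<epsilon> * (1 - \<epsilon>) \<le> exp \<epsilon> * exp (- \<epsilon>)"
    by (intro mult_left_mono) auto
  then have "exp \<epsilon> - 1 \<le> exp \<epsilon> * \<epsilon>"
    by (simp add: algebra_simps exp_minus)
  also have "\<dots> \<le> exp \<epsilon>\<^sub>0 * \<epsilon>"
    using \<open>0 \<le> \<epsilon>\<close> \<open>\<epsilon> \<le> \<epsilon>\<^sub>0\<close> by (intro mult_right_mono) auto
  finally show ?thesis .
qed

text \<open>For positive \<open>\<delta>\<close>, both
  \<open>\<delta>\<^sup>2 \<le> \<delta>\<close> and \<open>ln 2 \<le> ln (k / \<delta>)\<close>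
  hold; multiply and take roots. For \<open>\<delta> = 0\<close> both sides vanish through the
  factor \<open>\<delta>\<close> under the root.\<close>

lemma delta_le_sqrt:
  assumes "0 \<le> \<delta>" "\<delta> \<le> 1" "2 \<le> (k::real)"
  shows "\<delta> \<le> sqrt (\<delta> * ln (k / \<delta>)) / sqrt (ln 2)"
proof (cases "\<delta> = 0")
  case False
  then have "2 \<le> k / \<delta>"
    using assms by (simp add: le_divide_eq)
  then have "ln 2 \<le> ln (k / \<delta>)" by simp
  then have "\<delta>\<^sup>2 * ln 2 \<le> \<delta> * ln (k / \<delta>)"
    using assms by (intro mult_mono) (auto simp: power2_eq_square mult_left_le_one_le)
  then have "sqrt (\<delta>\<^sup>2 * ln 2) \<le> sqrt (\<delta> * ln (k / \<delta>))"
    by (rule real_sqrt_le_mono)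
  then show ?thesis
    using assms by (simp add: real_sqrt_mult le_divide_eq)
qed simp

section \<open>Choice of constants and conclusion\<close>

text \<open>The cap \<open>\<epsilon>\<^sub>0\<close> makes \<open>exp \<epsilon> - 1\<close>
  comparable to \<open>\<epsilon>\<close>; the constants are chosen from \<open>\<gamma>\<close> and
  \<open>\<epsilon>\<^sub>0\<close> before the family and the algorithm. The positivity conjuncts
  exclude a vacuous bound from \<open>C / 0 = 0\<close>.\<close>

theorem theorem3p1:
  fixes \<gamma> \<epsilon>\<^sub>0 :: real
  assumes "\<gamma> > 0"
  shows "\<exists>c>0. \<exists>C>0.
    \<forall>(X :: 'x measure) (S :: 's measure) (Y :: 'o measure) (V :: 'v set) (P :: 'v \<Rightarrow> 'x measure)
      (M :: ('x, 's, 'o) online_alg) (n :: nat) (\<epsilon> :: real) (\<delta> :: real).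
      finite V \<longrightarrow> V \<noteq> {} \<longrightarrow> (\<forall>v\<in>V. P v \<in> space (prob_algebra X)) \<longrightarrow>
      n \<ge> 1 \<longrightarrow> 0 \<le> \<epsilon> \<longrightarrow> \<epsilon> \<le> \<epsilon>\<^sub>0 \<longrightarrow> 0 \<le> \<delta> \<longrightarrow> \<delta> \<le> 1 \<longrightarrow>
      online_algorithm X S Y n M \<longrightarrow> pan_private X S Y n \<epsilon> \<delta> M \<longrightarrow>
      tv_dist (output_dist S M n (mixture_of_iid n V P))
              (output_dist S M n (iid n (uniform_mixture V P))) \<ge> \<gamma> \<longrightarrow>
      (let N = inf_to_2_norm X V P;
           D = \<epsilon> * N + sqrt (\<delta> * ln (real (card V) / \<delta>))
       in (D > 0 \<and> real n \<ge> C / D) \<and>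
          (\<delta> * ln (real (card V) / \<delta>) \<le> c * \<epsilon>\<^sup>2 * N\<^sup>2 \<longrightarrow>
             \<epsilon> * N > 0 \<and> real n \<ge> C / (\<epsilon> * N)))"
proof -
  \<comment> \<open>The first summand linearizes \<open>exp \<epsilon> - 1\<close>; the second
    converts the \<open>4 * \<delta>\<close> of each hybrid step into the square root term.\<close>
  define k where "k = exp \<epsilon>\<^sub>0 + 4 / sqrt (ln 2)"
  have k: "k > 0" unfolding k_def by (intro add_pos_nonneg) auto
  \<comment> \<open>The witnesses are \<open>c = 1\<close> and
    \<open>C = \<gamma> / (2 * k)\<close>. The factor 2 pays for replacing \<open>D\<close> by
    \<open>\<epsilon> * N\<close> in the second claim.\<close>
  show ?thesis
  proof (rule exI[of _ 1], rule conjI[OF zero_less_one], rule exI[of _ "\<gamma> / (2 * k)"], intro conjI allI impI)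
    show "\<gamma> / (2 * k) > 0" using assms k by simp
    fix X :: "'x measure" and S :: "'s measure" and Y :: "'o measure" and V :: "'v set"
      and P :: "'v \<Rightarrow> 'x measure" and M :: "('x, 's, 'o) online_alg" and n :: nat and \<epsilon> \<delta> :: real
    assume V: "finite V" "V \<noteq> {}" and "\<forall>v\<in>V. P v \<in> space (prob_algebra X)" and n: "n \<ge> 1"
      and \<epsilon>: "0 \<le> \<epsilon>" "\<epsilon> \<le> \<epsilon>\<^sub>0" and \<delta>: "0 \<le> \<delta>" "\<delta> \<le> 1"
      and alg: "online_algorithm X S Y n M" and pp: "pan_private X S Y n \<epsilon> \<delta> M"
      and far: "tv_dist (output_dist S M n (mixture_of_iid n V P))
              (output_dist S M n (iid n (uniform_mixture V P))) \<ge> \<gamma>"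
    then have P: "P v \<in> space (prob_algebra X)" if "v \<in> V" for v
      using that by blast
    define N where "N = inf_to_2_norm X V P"
    define L where "L = \<delta> * ln (real (card V) / \<delta>)"
    define D where "D = \<epsilon> * N + sqrt L"
    have N: "0 \<le> N" unfolding N_def by (rule inf_to_2_norm_nonneg[OF V P])
    have "card V \<noteq> 1"
    proof
      assume "card V = 1"
      then obtain v where Vv: "V = {v}" by (auto simp: card_1_singleton_iff)
      with P have Pv: "P v \<in> space (prob_algebra X)" by simp
      have "tv_dist (output_dist S M n (mixture_of_iid n V P)) (output_dist S M n (iid n (uniform_mixture V P))) = 0"
        unfolding Vv mixture_of_iid_eq_uniform_mixture
        using uniform_mixture_singleton[of P, OF Pv]
          uniform_mixture_singleton[of "\<lambda>v. iid n (P v)", OF prob_algebra_iid[OF Pv]]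
        by (simp add: tv_dist_self)
      then show False using far assms by simp
    qed
    moreover have "card V > 0" using V by (simp add: card_gt_0_iff)
    ultimately have "2 \<le> real (card V)" by linarith
    from delta_le_sqrt[OF \<delta> this] have \<delta>_le: "\<delta> \<le> sqrt L / sqrt (ln 2)"
      by (simp add: L_def)
    \<comment> \<open>The real \<open>sqrt\<close> is negative on negative arguments, so this sign
      needs proof; it follows from \<open>\<delta>_le\<close>.\<close>
    then have sL: "0 \<le> sqrt L"
      using \<delta>(1) by (auto simp: zero_le_divide_iff dest: order_trans)
    have "(exp \<epsilon> - 1) * N + 4 * \<delta> \<le> exp \<epsilon>\<^sub>0 * \<epsilon> * N + 4 * (sqrt L / sqrt (ln 2))"
      using exp_minus_one_le[OF \<epsilon>] N \<delta>_le by (intro add_mono mult_right_mono) auto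
    also have "\<dots> \<le> k * (\<epsilon> * N) + k * sqrt L"
      using \<epsilon> N sL by (intro add_mono) (auto simp: k_def algebra_simps)
    finally have \<kappa>: "(exp \<epsilon> - 1) * N + 4 * \<delta> \<le> k * D"
      by (simp add: D_def algebra_simps)
    have "\<gamma> \<le> n * ((exp \<epsilon> - 1) * N + 4 * \<delta>)"
      unfolding N_def by (rule order_trans[OF far tv_dist_output_le[where P = P, OF V P alg pp \<epsilon>(1) n]])
    also have "\<dots> \<le> n * (k * D)"
      using \<kappa> by (intro mult_left_mono) auto
    finally have main: "\<gamma> \<le> n * (k * D)" .
    then have D: "D > 0"
      using assms k n by (smt (verit) mult_nonneg_nonpos of_nat_0_le_iff)
    \<comment> \<open>Both claims are instances: \<open>E = D\<close> for the first, and
      \<open>E = \<epsilon> * N\<close> for the second, where the extra assumption gives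
      \<open>sqrt L \<le> \<epsilon> * N\<close>.\<close>
    have bound: "\<gamma> / (2 * k) / E \<le> n" if "E > 0" "D \<le> 2 * E" for E
    proof -
      have "\<gamma> \<le> n * (k * (2 * E))"
        using that k by (intro order_trans[OF main] mult_left_mono) auto
      then show ?thesis
        using k that(1) by (simp add: divide_le_eq algebra_simps)
    qed
    have "D > 0 \<and> real n \<ge> \<gamma> / (2 * k) / D"
      using D bound[of D] by simp
    moreover have "\<epsilon> * N > 0 \<and> real n \<ge> \<gamma> / (2 * k) / (\<epsilon> * N)" if "L \<le> 1 * \<epsilon>\<^sup>2 * N\<^sup>2"
    proof -
      have "sqrt L \<le> sqrt ((\<epsilon> * N)\<^sup>2)"
        using that by (intro real_sqrt_le_mono) (simp add: power_mult_distrib)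
      then have "sqrt L \<le> \<epsilon> * N"
        using \<epsilon> N by simp
      then have "D \<le> 2 * (\<epsilon> * N)"
        unfolding D_def by linarith
      then show ?thesis
        using D bound[of "\<epsilon> * N"] by simp
    qed
    ultimately show "let N = inf_to_2_norm X V P; D = \<epsilon> * N + sqrt (\<delta> * ln (real (card V) / \<delta>))
       in (D > 0 \<and> real n \<ge> \<gamma> / (2 * k) / D) \<and>
          (\<delta> * ln (real (card V) / \<delta>) \<le> 1 * \<epsilon>\<^sup>2 * N\<^sup>2 \<longrightarrow>
             \<epsilon> * N > 0 \<and> real n \<ge> \<gamma> / (2 * k) / (\<epsilon> * N))"
      unfolding Let_def N_def[symmetric] L_def[symmetric] D_def[symmetric] by blast
  qed
qed

end
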